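(* Let $(\mathbf{B},\|\cdot\|)$ be a real separable Banach space. Let $\{a_n;\, n\ge 1\}$ and $\{b_n;\, n\ge 1\}$ be increasing sequences of positive real numbers such that $\lim_{n\to\infty} a_n=\infty$ and $\{b_n/a_n;\, n\ge 1\}$ is a nondecreasing sequence. Suppose that, for every symmetric sequence $\{X,X_n;\, n\ge1\}$ of i.i.d. $\mathbf{B}$-valued random variables, with $S_n=\sum_{i=1}^n X_i$, $$\frac{S_n}{a_n}\to_{\mathbb{P}}0\quad\text{if and only if}\quad \lim_{n\to\infty} n\,\mathbb{P}(\|X\|>a_n)=0 .$$ Then, for every sequence $\{X,X_n;\, n\ge1\}$ of i.i.d. $\mathbf{B}$-valued random variables (not necessarily symmetric), with $S_n=\sum_{i=1}^nX_i$ and $\gamma_n=n\,\mathbb{E}\left(X I\{\|X\|\le b_n\}\right)$, $n\ge1$: (a) if $\lim_{n\to\infty} n\,\mathbb{P}(\|X\|>b_n)=0$, then $\dfrac{S_n-\gamma_n}{b_n}\to_{\mathbb{P}}0$; (b) if $\limsup_{n\to\infty} n\,\mathbb{P}(\|X\|>b_n)>0$, then $\limsup_{n\to\infty}\mathbb{P}\left(\dfrac{\|S_n-\gamma_n\|}{b_n}>\lambda\right)>0$ for every $\lambda>0$.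
   Context: A $\mathbf{B}$-valued random variable is a Borel measurable map from a probability space $(\Omega,\mathcal{F},\mathbb{P})$ into $\mathbf{B}$. A sequence $\{X,X_n;\,n\ge1\}$ of i.i.d. $\mathbf{B}$-valued random variables means that the $X_n$ are independent and each has the same distribution as $X$; it is called symmetric if $X$ and $-X$ have the same distribution. $\to_{\mathbb{P}}$ denotes convergence in probability, $I\{\cdot\}$ is the indicator function, and the expectation of a $\mathbf{B}$-valued random variable is the Bochner integral. "Increasing" means strictly increasing (as opposed to "nondecreasing"). *)

theory Defs
  imports "HOL-Probability.Probability"
begin

text \<open>Sequences \<open>(x\<^sub>n)\<close>, \<open>n \<ge> 1\<close>, are functions on \<^typ>\<open>nat\<close> whose value at \<open>0\<close> is never used.\<close>

definition iid_sequence ::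
    "'a measure \<Rightarrow> ('a \<Rightarrow> 'b::topological_space) \<Rightarrow> (nat \<Rightarrow> 'a \<Rightarrow> 'b) \<Rightarrow> bool" where
  "iid_sequence M X Xs \<longleftrightarrow>
     prob_space M \<and>
     X \<in> borel_measurable M \<and>
     prob_space.indep_vars M (\<lambda>_. borel) Xs {1..} \<and>
     (\<forall>n\<ge>1. distr M borel (Xs n) = distr M borel X)"

definition symmetric_rv :: "'a measure \<Rightarrow> ('a \<Rightarrow> 'b::real_normed_vector) \<Rightarrow> bool" where
  "symmetric_rv M X \<longleftrightarrow> distr M borel X = distr M borel (\<lambda>\<omega>. - X \<omega>)"

definition converges_in_prob ::
    "'a measure \<Rightarrow> (nat \<Rightarrow> 'a \<Rightarrow> 'b::metric_space) \<Rightarrow> ('a \<Rightarrow> 'b) \<Rightarrow> bool" where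
  "converges_in_prob M Y Z \<longleftrightarrow>
     (\<forall>\<epsilon>>0. (\<lambda>n. measure M {\<omega> \<in> space M. dist (Y n \<omega>) (Z \<omega>) > \<epsilon>}) \<longlonglongrightarrow> 0)"

definition partial_sum :: "(nat \<Rightarrow> 'a \<Rightarrow> 'b::comm_monoid_add) \<Rightarrow> nat \<Rightarrow> 'a \<Rightarrow> 'b" where
  "partial_sum Xs n \<omega> = (\<Sum>i=1..n. Xs i \<omega>)"

definition centering ::
    "'a measure \<Rightarrow> ('a \<Rightarrow> 'b::{banach, second_countable_topology}) \<Rightarrow> (nat \<Rightarrow> real) \<Rightarrow> nat \<Rightarrow> 'b" where
  "centering M X b n = real n *\<^sub>R (LINT \<omega>:{\<omega> \<in> space M. norm (X \<omega>) \<le> b n}|M. X \<omega>)"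

text \<open>
  A premise cannot quantify over probability spaces on all types at once. The following condition
  ranges over all probability measures on the type \<^typ>\<open>nat \<Rightarrow> 'b\<close>. Every i.i.d. sequence
  \<open>X, X\<^sub>1, X\<^sub>2, \<dots>\<close> on any probability space has a copy there, namely the coordinate maps under
  the product measure of the law of \<open>X\<close>, with \<open>X\<close> replaced by \<open>X\<^sub>1\<close>; the two sides of the
  equivalence depend only on the law of \<open>X\<close>. So this is the condition for all
  probability spaces.
\<close>
definition symmetric_weak_law ::
    "'b::{banach, second_countable_topology} itself \<Rightarrow> (nat \<Rightarrow> real) \<Rightarrow> bool" where
  "symmetric_weak_law _ a \<longleftrightarrow>
     (\<forall>(M :: (nat \<Rightarrow> 'b) measure) (X :: (nat \<Rightarrow> 'b) \<Rightarrow> 'b) Xs.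
        iid_sequence M X Xs \<longrightarrow> symmetric_rv M X \<longrightarrow>
        (converges_in_prob M (\<lambda>n \<omega>. partial_sum Xs n \<omega> /\<^sub>R a n) (\<lambda>_. 0) \<longleftrightarrow>
         (\<lambda>n. real n * measure M {\<omega> \<in> space M. norm (X \<omega>) > a n}) \<longlonglongrightarrow> 0))"

end

theory Submission
  imports Defs
begin

text \<open>
  If \<open>X\<close> is symmetric with \<open>n P(\<parallel>X\<parallel> > b\<^sub>n) \<rightarrow> 0\<close>, rescale it to \<open>Y = w(\<parallel>X\<parallel>) X\<close>, where \<open>w(t) = a\<^sub>m / b\<^sub>m\<close>
  for the least \<open>m\<close> with \<open>t \<le> b\<^sub>m\<close>. Monotonicity of \<open>b\<^sub>n / a\<^sub>n\<close> makes \<open>\<parallel>Y\<parallel> > a\<^sub>n\<close> imply \<open>\<parallel>X\<parallel> > b\<^sub>n\<close>, so the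
  assumed law applies to \<open>Y\<close>; by the Hoffmann-Jorgensen inequality the sums of \<open>Y\<close> truncated at
  \<open>\<parallel>X\<parallel> \<le> b\<^sub>n\<close> are \<open>o(a\<^sub>n)\<close> in \<open>L\<^sub>1\<close>. There \<open>X / b\<^sub>n\<close> is \<open>Y / a\<^sub>n\<close> times an even factor in \<open>[0, 1]\<close>, and the contraction
  principle gives the law for \<open>X\<close> with norming \<open>b\<^sub>n\<close>.

  For (a), the differences \<open>(X\<^sub>2\<^sub>i - X\<^sub>2\<^sub>i\<^sub>+\<^sub>1) / 2\<close> are symmetric with small tails. Truncating and using the
  Hoffmann-Jorgensen inequality once more gives \<open>L\<^sub>1\<close> convergence of the symmetrized truncated sums, which by
  Jensen's inequality dominate the sums centered at their mean.
  For (b), Levy's inequality turns convergence of the symmetrized sums into a tail bound at some multiple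
  of \<open>b\<^sub>n\<close>; the symmetric law just proved, followed by Levy's inequality again, improves it to every
  multiple, and desymmetrizing gives the tail bound for \<open>X\<close>.
\<close>

section \<open>Laws of i.i.d. sequences\<close>

lemma iid_sequenceD:
  assumes "iid_sequence M X Xs"
  shows "prob_space M" "X \<in> borel_measurable M"
    "prob_space.indep_vars M (\<lambda>_. borel) Xs {1..}"
    "\<And>n. n \<ge> 1 \<Longrightarrow> Xs n \<in> borel_measurable M"
    "\<And>n. n \<ge> 1 \<Longrightarrow> distr M borel (Xs n) = distr M borel X"
proof -
  show ps: "prob_space M" and "X \<in> borel_measurable M"
    and ind: "prob_space.indep_vars M (\<lambda>_. borel) Xs {1..}"
    and "\<And>n. n \<ge> 1 \<Longrightarrow> distr M borel (Xs n) = distr M borel X"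
    using assms by (auto simp: iid_sequence_def)
  interpret prob_space M by (rule ps)
  show "\<And>n. n \<ge> 1 \<Longrightarrow> Xs n \<in> borel_measurable M"
    using ind by (auto simp: indep_vars_def2)
qed

lemma partial_sum_measurable:
  fixes X :: "'a \<Rightarrow> 'b::{banach, second_countable_topology}"
  assumes "iid_sequence M X Xs"
  shows "partial_sum Xs n \<in> borel_measurable M"
proof -
  have "(\<lambda>\<omega>. partial_sum Xs n \<omega>) \<in> borel_measurable M"
    unfolding partial_sum_def by (intro borel_measurable_sum iid_sequenceD(4)[OF assms]) auto
  then show ?thesis by simp
qed

text \<open>Independence is the product form of the joint law, so every probability about the
  sequence is determined by the law of \<open>X\<close> alone. This is what allows sequences on
  different probability spaces to be compared.\<close>

lemma distr_iid_sequence: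
  assumes "iid_sequence M X Xs"
  shows "distr M (PiM {1..} (\<lambda>_. borel)) (\<lambda>\<omega>. \<lambda>i\<in>{1..}. Xs i \<omega>) =
    PiM {1..} (\<lambda>_. distr M borel X)"
proof -
  note D = iid_sequenceD[OF assms]
  interpret prob_space M by (rule D)
  have "distr M (PiM {1..} (\<lambda>_. borel)) (\<lambda>\<omega>. \<lambda>i\<in>{1..}. Xs i \<omega>) =
      PiM {1..} (\<lambda>i. distr M borel (Xs i))"
    using D(3,4) by (subst (asm) indep_vars_iff_distr_eq_PiM') auto
  also have "\<dots> = PiM {1..} (\<lambda>_. distr M borel X)"
    by (rule PiM_cong) (use D(5) in auto)
  finally show ?thesis .
qed

lemma iid_sequence_restrict_measurable:
  assumes "iid_sequence M X Xs"
  shows "(\<lambda>\<omega>. \<lambda>i\<in>{1..}. Xs i \<omega>) \<in> measurable M (PiM {1..} (\<lambda>_. borel))"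
  by (intro measurable_restrict iid_sequenceD(4)[OF assms]) auto

text \<open>Both sides integrate \<open>h\<close> against the same product measure. The sign-flip
  identity below is the case in which one of the two sequences is a reflection of the other.\<close>

lemma iid_sequence_integral_eq:
  fixes h :: "(nat \<Rightarrow> 'b::topological_space) \<Rightarrow> real"
  assumes "iid_sequence M X Xs" "iid_sequence N Y Ys" "distr M borel X = distr N borel Y"
    and h: "h \<in> borel_measurable (PiM {1..} (\<lambda>_. borel))"
  shows "(\<integral>\<omega>. h (\<lambda>i\<in>{1..}. Xs i \<omega>) \<partial>M) = (\<integral>\<omega>. h (\<lambda>i\<in>{1..}. Ys i \<omega>) \<partial>N)"
proof -
  have "(\<integral>\<omega>. h (\<lambda>i\<in>{1..}. Xs i \<omega>) \<partial>M) =
      (\<integral>x. h x \<partial>distr M (PiM {1..} (\<lambda>_. borel)) (\<lambda>\<omega>. \<lambda>i\<in>{1..}. Xs i \<omega>))"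
    by (rule integral_distr[symmetric, OF iid_sequence_restrict_measurable[OF assms(1)] h])
  also have "\<dots> = (\<integral>x. h x \<partial>distr N (PiM {1..} (\<lambda>_. borel)) (\<lambda>\<omega>. \<lambda>i\<in>{1..}. Ys i \<omega>))"
    unfolding distr_iid_sequence[OF assms(1)] distr_iid_sequence[OF assms(2)] assms(3) ..
  also have "\<dots> = (\<integral>\<omega>. h (\<lambda>i\<in>{1..}. Ys i \<omega>) \<partial>N)"
    by (rule integral_distr[OF iid_sequence_restrict_measurable[OF assms(2)] h])
  finally show ?thesis .
qed

lemma measure_distr_eq:
  assumes "distr M borel X = distr N borel Y" "X \<in> borel_measurable M" "Y \<in> borel_measurable N"
    and [measurable]: "Measurable.pred borel P"
  shows "measure M {\<omega> \<in> space M. P (X \<omega>)} = measure N {\<omega> \<in> space N. P (Y \<omega>)}"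
proof -
  have "measure M {\<omega> \<in> space M. P (X \<omega>)} = measure (distr M borel X) {x. P x}"
    using assms(2) by (subst measure_distr) (auto simp: vimage_def Int_def conj_commute)
  moreover have "measure N {\<omega> \<in> space N. P (Y \<omega>)} = measure (distr N borel Y) {x. P x}"
    using assms(3) by (subst measure_distr) (auto simp: vimage_def Int_def conj_commute)
  ultimately show ?thesis using assms(1) by simp
qed

lemma distr_eq_compose:
  assumes "distr M borel X = distr N borel Y" "X \<in> borel_measurable M" "Y \<in> borel_measurable N"
    and f: "f \<in> borel_measurable borel"
  shows "distr M borel (\<lambda>\<omega>. f (X \<omega>)) = distr N borel (\<lambda>\<omega>. f (Y \<omega>))"
  using distr_distr[OF f assms(2)] distr_distr[OF f assms(3)] assms(1) by (simp add: comp_def)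

lemma iid_sequence_partial_sum_distr_eq:
  fixes X :: "'a \<Rightarrow> 'b::{banach, second_countable_topology}" and Y :: "'c \<Rightarrow> 'b"
  assumes X: "iid_sequence M X Xs" and Y: "iid_sequence N Y Ys"
    and eq: "distr M borel X = distr N borel Y"
  shows "distr M borel (partial_sum Xs n) = distr N borel (partial_sum Ys n)"
proof -
  let ?h = "\<lambda>x. \<Sum>i=1..n. x i :: 'b"
  have h: "?h \<in> borel_measurable (PiM {1..} (\<lambda>_. borel))"
    by (intro borel_measurable_sum measurable_component_singleton) auto
  have "distr L borel (partial_sum Zs n) =
      distr (distr L (PiM {1..} (\<lambda>_. borel)) (\<lambda>\<omega>. \<lambda>i\<in>{1..}. Zs i \<omega>)) borel ?h"
    if "iid_sequence L Z Zs" for L :: "'d measure" and Z Zs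
    unfolding distr_distr[OF h iid_sequence_restrict_measurable[OF that]]
    by (intro arg_cong[where f="distr L borel"]) (simp add: fun_eq_iff partial_sum_def)
  from this[OF X] this[OF Y] show ?thesis
    unfolding distr_iid_sequence[OF X] distr_iid_sequence[OF Y] eq by simp
qed

lemma integral_distr_cong:
  fixes f :: "'b::topological_space \<Rightarrow> real"
  assumes "distr M borel X = distr N borel Y" "X \<in> borel_measurable M" "Y \<in> borel_measurable N"
    and "f \<in> borel_measurable borel"
  shows "integrable M (\<lambda>\<omega>. f (X \<omega>)) \<longleftrightarrow> integrable N (\<lambda>\<omega>. f (Y \<omega>))"
    and "(\<integral>\<omega>. f (X \<omega>) \<partial>M) = (\<integral>\<omega>. f (Y \<omega>) \<partial>N)"
  using integrable_distr_eq[OF assms(2,4)] integrable_distr_eq[OF assms(3,4)]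
    integral_distr[OF assms(2,4)] integral_distr[OF assms(3,4)] assms(1) by simp_all

lemma iid_sequence_partial_sum_prob_eq:
  fixes X :: "'a \<Rightarrow> 'b::{banach, second_countable_topology}" and Y :: "'c \<Rightarrow> 'b"
  assumes X: "iid_sequence M X Xs" and Y: "iid_sequence N Y Ys"
    and eq: "distr M borel X = distr N borel Y"
    and P: "Measurable.pred borel P"
  shows "measure M {\<omega> \<in> space M. P (partial_sum Xs n \<omega>)} =
    measure N {\<omega> \<in> space N. P (partial_sum Ys n \<omega>)}"
  by (rule measure_distr_eq[OF iid_sequence_partial_sum_distr_eq[OF X Y eq] _ _ P])
    (rule partial_sum_measurable[OF X] partial_sum_measurable[OF Y])+

lemma iid_sequence_compose:
  assumes "iid_sequence M X Xs" and f: "f \<in> borel_measurable borel"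
  shows "iid_sequence M (\<lambda>\<omega>. f (X \<omega>)) (\<lambda>i \<omega>. f (Xs i \<omega>))"
proof -
  note D = iid_sequenceD[OF assms(1)]
  interpret prob_space M by (rule D)
  have "distr M borel (\<lambda>\<omega>. f (Z \<omega>)) = distr (distr M borel Z) borel f"
    if "Z \<in> borel_measurable M" for Z
    using distr_distr[OF f that] by (simp add: comp_def)
  then show ?thesis
    using D f indep_vars_compose2[OF D(3), of "\<lambda>_. f" "\<lambda>_. borel"]
    by (auto simp: iid_sequence_def intro: measurable_compose[OF _ f])
qed

lemma iid_sequence_const_law:
  assumes "iid_sequence M X Xs" "Y \<in> borel_measurable M" "distr M borel Y = distr M borel X"
  shows "iid_sequence M Y Xs"
  using assms by (auto simp: iid_sequence_def)

text \<open>The canonical model of a law: the coordinates 1, 2, ... form the sequence, and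
  coordinate 0 serves as the generic variable.\<close>

lemma iid_sequence_PiM:
  fixes \<rho> :: "'b::{banach, second_countable_topology} measure"
  assumes \<rho>: "prob_space \<rho>" "sets \<rho> = sets borel"
  shows "iid_sequence (PiM UNIV (\<lambda>_::nat. \<rho>)) (\<lambda>x. x 0) (\<lambda>i x. x i)"
    and "distr (PiM UNIV (\<lambda>_::nat. \<rho>)) borel (\<lambda>x. x 0) = \<rho>"
proof -
  let ?P = "PiM UNIV (\<lambda>_::nat. \<rho>)"
  interpret P: prob_space ?P by (intro prob_space_PiM \<rho>)
  have law: "distr ?P borel (\<lambda>x. x i) = \<rho>" for i
  proof -
    have "distr ?P \<rho> (\<lambda>x. x i) = \<rho>"
      using distr_PiM_component[of UNIV "\<lambda>_. \<rho>" i] \<rho> by auto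
    moreover have "distr ?P borel (\<lambda>x. x i) = distr ?P \<rho> (\<lambda>x. x i)"
      by (rule distr_cong) (simp_all add: \<rho>)
    ultimately show ?thesis by simp
  qed
  have m: "(\<lambda>x. x i) \<in> measurable ?P borel" for i
    using measurable_component_singleton[of i UNIV "\<lambda>_. \<rho>"]
    unfolding measurable_cong_sets[OF refl \<rho>(2)] by simp
  have "P.indep_vars (\<lambda>_. borel) (\<lambda>i x. x i) UNIV"
  proof (subst P.indep_vars_iff_distr_eq_PiM)
    \<comment> \<open>\<open>borel\<close> and \<open>\<rho>\<close> have the same measurable sets,
      so exchanging one for the other in the target of \<open>distr\<close> changes nothing.\<close>
    have "distr ?P (PiM UNIV (\<lambda>_. borel)) (\<lambda>x. \<lambda>i\<in>UNIV. x i) = distr ?P ?P (\<lambda>x. x)"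
      by (rule distr_cong) (auto intro!: sets_PiM_cong simp: \<rho>)
    also have "\<dots> = ?P" by (rule distr_id)
    finally show "distr ?P (PiM UNIV (\<lambda>_. borel)) (\<lambda>x. \<lambda>i\<in>UNIV. x i) =
        PiM UNIV (\<lambda>i. distr ?P borel (\<lambda>x. x i))"
      by (simp add: law)
  qed (use m in auto)
  then have "P.indep_vars (\<lambda>_. borel) (\<lambda>i x. x i) {1..}"
    by (rule P.indep_vars_subset) auto
  then show "iid_sequence ?P (\<lambda>x. x 0) (\<lambda>i x. x i)" "distr ?P borel (\<lambda>x. x 0) = \<rho>"
    using m law by (auto simp: iid_sequence_def P.prob_space_axioms)
qed

text \<open>The assumed law speaks only about measures on \<open>nat \<Rightarrow> 'b\<close>. It is
  applied to the canonical model of the law of \<open>X\<close> and carried back to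
  \<open>M\<close>, since both the tail and the law of each partial sum depend only on the law of
  \<open>X\<close>.\<close>

lemma symmetric_weak_lawD:
  fixes X :: "'a \<Rightarrow> 'b::{banach, second_countable_topology}"
  assumes wl: "symmetric_weak_law TYPE('b) a" and X: "iid_sequence M X Xs" "symmetric_rv M X"
    and tail: "(\<lambda>n. real n * measure M {\<omega> \<in> space M. norm (X \<omega>) > a n}) \<longlonglongrightarrow> 0"
    and "\<epsilon> > 0" and apos: "\<And>n. n \<ge> 1 \<Longrightarrow> a n > 0"
  shows "(\<lambda>n. measure M {\<omega> \<in> space M. norm (partial_sum Xs n \<omega>) > \<epsilon> * a n}) \<longlonglongrightarrow> 0"
proof -
  note D = iid_sequenceD[OF X(1)]
  interpret prob_space M by (rule D)
  let ?\<rho> = "distr M borel X"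
  let ?P = "PiM UNIV (\<lambda>_::nat. ?\<rho>)"
  have \<rho>: "prob_space ?\<rho>" "sets ?\<rho> = sets borel"
    using D(2) by (auto intro: prob_space_distr)
  note P = iid_sequence_PiM[OF \<rho>] and PD = iid_sequenceD[OF iid_sequence_PiM(1)[OF \<rho>]]
  have "symmetric_rv ?P (\<lambda>x. x 0)"
    unfolding symmetric_rv_def
    using distr_eq_compose[OF P(2) PD(2) D(2), of uminus] P(2) X(2)
    by (simp add: symmetric_rv_def)
  moreover have "measure ?P {x \<in> space ?P. norm (x 0) > a n} = measure M {\<omega> \<in> space M. norm (X \<omega>) > a n}" for n
    by (rule measure_distr_eq[OF P(2) PD(2) D(2)]) measurable
  ultimately have conv: "converges_in_prob ?P (\<lambda>n \<omega>. partial_sum (\<lambda>i x. x i) n \<omega> /\<^sub>R a n) (\<lambda>_. 0)"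
    using wl P(1) tail unfolding symmetric_weak_law_def by auto
  have "(\<lambda>n. measure ?P {\<omega> \<in> space ?P. norm (partial_sum (\<lambda>i x. x i) n \<omega> /\<^sub>R a n) > \<epsilon>}) \<longlonglongrightarrow> 0"
    using conv \<open>\<epsilon> > 0\<close> by (simp add: converges_in_prob_def)
  \<comment> \<open>Positivity of \<open>a n\<close> turns the normalised sum into a threshold. It
    is known from \<open>n = 1\<close> on, which suffices for the limit.\<close>
  moreover have "measure ?P {\<omega> \<in> space ?P. norm (partial_sum (\<lambda>i x. x i) n \<omega> /\<^sub>R a n) > \<epsilon>} =
      measure M {\<omega> \<in> space M. norm (partial_sum Xs n \<omega>) > \<epsilon> * a n}" if "n \<ge> 1" for n
  proof -
    have "measure ?P {\<omega> \<in> space ?P. norm (partial_sum (\<lambda>i x. x i) n \<omega> /\<^sub>R a n) > \<epsilon>} =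
       measure ?P {\<omega> \<in> space ?P. norm (partial_sum (\<lambda>i x. x i) n \<omega>) > \<epsilon> * a n}"
      using apos[OF that] by (intro arg_cong[where f="measure ?P"]) (auto simp: field_simps)
    also have "\<dots> = measure M {\<omega> \<in> space M. norm (partial_sum Xs n \<omega>) > \<epsilon> * a n}"
      by (rule iid_sequence_partial_sum_prob_eq[OF P(1) X(1) P(2)]) measurable
    finally show ?thesis .
  qed
  ultimately show ?thesis
    by (elim Lim_transform_eventually) (auto simp: eventually_at_top_linorder intro!: exI[of _ 1])
qed

text \<open>The blocks \<open>{2 * j, 2 * j + 1}\<close> with \<open>j \<ge> 1\<close> are disjoint,
  so functions of them are independent and share one law. Independent copies are thus found inside
  the given sequence, without enlarging the probability space; the first block is
  \<open>{2, 3}\<close>.\<close>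

lemma iid_sequence_pairing:
  fixes X :: "'a \<Rightarrow> 'b::{banach, second_countable_topology}" and g :: "'b \<Rightarrow> 'b \<Rightarrow> 'b"
  assumes X: "iid_sequence M X Xs" and g[measurable]: "(\<lambda>(x, y). g x y) \<in> borel_measurable (borel \<Otimes>\<^sub>M borel)"
  shows "iid_sequence M (\<lambda>\<omega>. g (Xs 2 \<omega>) (Xs 3 \<omega>)) (\<lambda>i \<omega>. g (Xs (2 * i) \<omega>) (Xs (2 * i + 1) \<omega>))"
    and "distr M (borel \<Otimes>\<^sub>M borel) (\<lambda>\<omega>. (Xs 2 \<omega>, Xs 3 \<omega>)) = distr M borel X \<Otimes>\<^sub>M distr M borel X"
proof -
  note D = iid_sequenceD[OF X]
  interpret prob_space M by (rule D)
  have ind: "indep_vars (\<lambda>j. PiM {2*j, 2*j+1} (\<lambda>_. borel))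
      (\<lambda>j \<omega>. restrict (\<lambda>i. Xs i \<omega>) {2*j, 2*j+1}) {1..}"
    using D(3)
  proof (rule indep_vars_restrict)
    show "disjoint_family_on (\<lambda>j::nat. {2 * j, 2 * j + 1}) {1..}"
      unfolding disjoint_family_on_def
    proof (intro ballI impI)
      fix m n :: nat
      assume "m \<noteq> n"
      moreover have "2 * m \<noteq> 2 * n + 1" "2 * m + 1 \<noteq> 2 * n" by presburger+
      ultimately show "{2 * m, 2 * m + 1} \<inter> {2 * n, 2 * n + 1} = {}" by auto
    qed
  qed auto
  have "indep_vars (\<lambda>_. borel) (\<lambda>j \<omega>. (\<lambda>x. g (x (2*j)) (x (2*j+1))) (restrict (\<lambda>i. Xs i \<omega>) {2*j, 2*j+1})) {1..}"
  proof (rule indep_vars_compose2[OF ind])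
    fix j :: nat
    have "(\<lambda>x. (x (2*j), x (2*j+1))) \<in> measurable (PiM {2*j, 2*j+1} (\<lambda>_. borel::'b measure)) (borel \<Otimes>\<^sub>M borel)"
      by (intro measurable_Pair measurable_component_singleton) auto
    from measurable_compose[OF this g]
    show "(\<lambda>x. g (x (2*j)) (x (2*j+1))) \<in> borel_measurable (PiM {2*j, 2*j+1} (\<lambda>_. borel::'b measure))"
      by simp
  qed
  then have 1: "indep_vars (\<lambda>_. borel) (\<lambda>j \<omega>. g (Xs (2*j) \<omega>) (Xs (2*j+1) \<omega>)) {1..}" by simp
  have pair: "distr M (borel \<Otimes>\<^sub>M borel) (\<lambda>\<omega>. (Xs (2*i) \<omega>, Xs (2*i+1) \<omega>)) = distr M borel X \<Otimes>\<^sub>M distr M borel X"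
    if "i \<ge> 1" for i
  proof -
    have "indep_var (PiM {2*i} (\<lambda>_. borel)) (\<lambda>\<omega>. restrict (\<lambda>i. Xs i \<omega>) {2*i})
        (PiM {2*i+1} (\<lambda>_. borel)) (\<lambda>\<omega>. restrict (\<lambda>i. Xs i \<omega>) {2*i+1})"
      using that by (intro indep_var_restrict[OF D(3)]) auto
    then have "indep_var borel ((\<lambda>x. x (2*i)) \<circ> (\<lambda>\<omega>. restrict (\<lambda>i. Xs i \<omega>) {2*i}))
        borel ((\<lambda>x. x (2*i+1)) \<circ> (\<lambda>\<omega>. restrict (\<lambda>i. Xs i \<omega>) {2*i+1}))"
      by (rule indep_var_compose) (auto intro: measurable_component_singleton)
    then have "indep_var borel (Xs (2*i)) borel (Xs (2*i+1))" by (simp add: comp_def)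
    then show ?thesis using that D(5) by (simp add: indep_var_distribution_eq)
  qed
  show "distr M (borel \<Otimes>\<^sub>M borel) (\<lambda>\<omega>. (Xs 2 \<omega>, Xs 3 \<omega>)) = distr M borel X \<Otimes>\<^sub>M distr M borel X"
    using pair[of 1] by (simp add: numeral_eq_Suc)
  have law: "distr M borel (\<lambda>\<omega>. g (Xs (2*i) \<omega>) (Xs (2*i+1) \<omega>)) =
      distr (distr M borel X \<Otimes>\<^sub>M distr M borel X) borel (\<lambda>(x, y). g x y)" if "i \<ge> 1" for i
  proof -
    have "(\<lambda>\<omega>. (Xs (2*i) \<omega>, Xs (2*i+1) \<omega>)) \<in> measurable M (borel \<Otimes>\<^sub>M borel)"
      using that by (intro measurable_Pair D(4)) auto
    from distr_distr[OF g this] show ?thesis unfolding comp_def pair[OF that] by simp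
  qed
  have "(\<lambda>\<omega>. (Xs 2 \<omega>, Xs 3 \<omega>)) \<in> measurable M (borel \<Otimes>\<^sub>M borel)"
    by (intro measurable_Pair D(4)) auto
  from measurable_compose[OF this g]
  have m: "(\<lambda>\<omega>. g (Xs 2 \<omega>) (Xs 3 \<omega>)) \<in> borel_measurable M" by simp
  have "distr M borel (\<lambda>\<omega>. g (Xs (2*i) \<omega>) (Xs (2*i+1) \<omega>)) = distr M borel (\<lambda>\<omega>. g (Xs 2 \<omega>) (Xs 3 \<omega>))"
    if "i \<ge> 1" for i
    using law[OF that] law[of 1] by (simp add: numeral_eq_Suc)
  with 1 m show "iid_sequence M (\<lambda>\<omega>. g (Xs 2 \<omega>) (Xs 3 \<omega>)) (\<lambda>i \<omega>. g (Xs (2 * i) \<omega>) (Xs (2 * i + 1) \<omega>))"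
    using prob_space_axioms by (auto simp: iid_sequence_def)
qed

text \<open>The joint law of the pair is a product of two equal factors, hence invariant under
  exchange of the coordinates, and the exchange turns \<open>g\<close> into
  \<open>- g\<close>.\<close>

lemma symmetric_rv_pairing:
  fixes X :: "'a \<Rightarrow> 'b::{banach, second_countable_topology}" and g :: "'b \<Rightarrow> 'b \<Rightarrow> 'b"
  assumes X: "iid_sequence M X Xs" and g[measurable]: "(\<lambda>(x, y). g x y) \<in> borel_measurable (borel \<Otimes>\<^sub>M borel)"
    and swap: "\<And>x y. g y x = - g x y"
  shows "symmetric_rv M (\<lambda>\<omega>. g (Xs 2 \<omega>) (Xs 3 \<omega>))"
proof -
  note D = iid_sequenceD[OF X]
  interpret prob_space M by (rule D)
  let ?\<nu> = "distr M borel X"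
  interpret \<nu>: prob_space ?\<nu> using D(2) by (rule prob_space_distr)
  interpret \<nu>\<nu>: pair_prob_space ?\<nu> ?\<nu> ..
  have swap': "(\<lambda>(x, y). g y x) = (\<lambda>(x, y). - g x y)"
    by (rule ext, clarify, rule swap)
  have m: "(\<lambda>\<omega>. (Xs 2 \<omega>, Xs 3 \<omega>)) \<in> measurable M (borel \<Otimes>\<^sub>M borel)"
    by (intro measurable_Pair D(4)) auto
  have 1: "distr M borel (\<lambda>\<omega>. h (Xs 2 \<omega>) (Xs 3 \<omega>)) = distr (?\<nu> \<Otimes>\<^sub>M ?\<nu>) borel (\<lambda>(x, y). h x y)"
    if "(\<lambda>(x, y). h x y) \<in> borel_measurable (borel \<Otimes>\<^sub>M borel)" for h :: "'b \<Rightarrow> 'b \<Rightarrow> 'b"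
    using distr_distr[OF that m] iid_sequence_pairing(2)[OF X g] by (simp add: comp_def)
  have "distr (?\<nu> \<Otimes>\<^sub>M ?\<nu>) borel (\<lambda>(x, y). g x y) =
      distr (distr (?\<nu> \<Otimes>\<^sub>M ?\<nu>) (?\<nu> \<Otimes>\<^sub>M ?\<nu>) (\<lambda>(x, y). (y, x))) borel (\<lambda>(x, y). g x y)"
    using \<nu>\<nu>.distr_pair_swap by simp
  also have "\<dots> = distr (?\<nu> \<Otimes>\<^sub>M ?\<nu>) borel (\<lambda>(x, y). g y x)"
  proof (subst distr_distr)
    show "(\<lambda>(x, y). g x y) \<in> borel_measurable (?\<nu> \<Otimes>\<^sub>M ?\<nu>)"
      using g by (simp cong: measurable_cong_sets sets_pair_measure_cong)
  qed (auto simp: comp_def split_beta' measurable_pair_swap')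
  finally have "distr (?\<nu> \<Otimes>\<^sub>M ?\<nu>) borel (\<lambda>(x, y). g x y) = distr (?\<nu> \<Otimes>\<^sub>M ?\<nu>) borel (\<lambda>(x, y). - g x y)"
    unfolding swap' .
  moreover have "(\<lambda>(x, y). - g x y) \<in> borel_measurable (borel \<Otimes>\<^sub>M borel)"
    using borel_measurable_uminus[OF g] by (simp add: split_beta')
  ultimately show ?thesis
    using 1[OF g] 1[of "\<lambda>x y. - g x y"] by (simp add: symmetric_rv_def)
qed

section \<open>Inequalities for sums of symmetric variables\<close>

text \<open>Signs on a deterministic set of positions preserve independence, and by symmetry they
  preserve each marginal law. All reflection arguments below rest on this, with \<open>A\<close> an
  initial segment, a final segment or a single index.\<close>

lemma iid_sequence_flip:
  fixes X :: "'a \<Rightarrow> 'b::{banach, second_countable_topology}"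
  assumes X: "iid_sequence M X Xs" "symmetric_rv M X"
  shows "iid_sequence M X (\<lambda>i \<omega>. if i \<in> A then - Xs i \<omega> else Xs i \<omega>)"
proof -
  note D = iid_sequenceD[OF X(1)]
  interpret prob_space M by (rule D)
  have ind: "indep_vars (\<lambda>_. borel) (\<lambda>i \<omega>. (if i \<in> A then - Xs i \<omega> else Xs i \<omega>)) {1..}"
    by (rule indep_vars_compose2[OF D(3), of "\<lambda>i x. if i \<in> A then - x else x"]) auto
  have "distr M borel (\<lambda>\<omega>. - Xs i \<omega>) = distr M borel X" if "i \<ge> 1" for i
    using distr_eq_compose[OF D(5)[OF that] D(4)[OF that] D(2), of uminus] X(2)
    by (simp add: symmetric_rv_def)
  with D(5) have "distr M borel (\<lambda>\<omega>. if i \<in> A then - Xs i \<omega> else Xs i \<omega>) = distr M borel X"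
    if "i \<ge> 1" for i
    using that by (cases "i \<in> A") auto
  with ind show ?thesis
    using D(1,2) by (auto simp: iid_sequence_def)
qed

lemma symmetric_integral_flip:
  fixes X :: "'a \<Rightarrow> 'b::{banach, second_countable_topology}"
    and h :: "(nat \<Rightarrow> 'b) \<Rightarrow> real"
  assumes X: "iid_sequence M X Xs" "symmetric_rv M X"
    and h: "h \<in> borel_measurable (PiM {1..} (\<lambda>_. borel))"
  shows "(\<integral>\<omega>. h (\<lambda>i\<in>{1..}. if i \<in> A then - Xs i \<omega> else Xs i \<omega>) \<partial>M) =
    (\<integral>\<omega>. h (\<lambda>i\<in>{1..}. Xs i \<omega>) \<partial>M)"
  by (rule iid_sequence_integral_eq[OF iid_sequence_flip[OF X] X(1) refl h])

section \<open>First passage times and Levy's maximal inequality\<close>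

definition first_exceed :: "(nat \<Rightarrow> 'a \<Rightarrow> 'b::real_normed_vector) \<Rightarrow> real \<Rightarrow> nat \<Rightarrow> 'a \<Rightarrow> bool" where
  "first_exceed Xs t k \<omega> \<longleftrightarrow>
     norm (partial_sum Xs k \<omega>) > t \<and> (\<forall>j<k. norm (partial_sum Xs j \<omega>) \<le> t)"

lemma measure_eq_integral_of_bool:
  "measure M {\<omega> \<in> space M. P \<omega>} = (\<integral>\<omega>. of_bool (P \<omega>) \<partial>M)"
proof -
  have "(\<integral>\<omega>. of_bool (P \<omega>) \<partial>M) = (\<integral>\<omega>. indicator {\<omega> \<in> space M. P \<omega>} \<omega> \<partial>M :: real)"
    by (rule Bochner_Integration.integral_cong) auto
  then show ?thesis by (simp add: Int_absorb2 Collect_restrict)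
qed

lemma first_exceed_ex:
  assumes "norm (partial_sum Xs m \<omega>) > t" "t \<ge> 0"
  obtains k where "1 \<le> k" "k \<le> m" "first_exceed Xs t k \<omega>"
proof -
  define k where "k = (LEAST k. norm (partial_sum Xs k \<omega>) > t)"
  have "norm (partial_sum Xs k \<omega>) > t" unfolding k_def using assms(1) by (rule LeastI)
  moreover have "k \<le> m" unfolding k_def using assms(1) by (rule Least_le)
  moreover have "norm (partial_sum Xs j \<omega>) \<le> t" if "j < k" for j
    using not_less_Least[of j "\<lambda>k. norm (partial_sum Xs k \<omega>) > t"] that by (simp add: k_def)
  \<comment> \<open>At time 0 the sum is empty and its norm 0 does not exceed a level
    \<open>t \<ge> 0\<close>.\<close>
  moreover have "k \<noteq> 0" using calculation(1) assms(2) by (auto simp: partial_sum_def intro!: gr0I)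
  ultimately show ?thesis using that[of k] by (auto simp: first_exceed_def)
qed

lemma first_exceed_unique: "first_exceed Xs t j \<omega> \<Longrightarrow> first_exceed Xs t k \<omega> \<Longrightarrow> j = k"
  by (rule linorder_cases[of j k]) (auto simp: first_exceed_def not_less[symmetric])

lemma first_exceed_measurable:
  fixes X :: "'a \<Rightarrow> 'b::{banach, second_countable_topology}"
  assumes "iid_sequence M X Xs"
  shows "Measurable.pred M (first_exceed Xs t k)"
proof -
  have "Measurable.pred M (\<lambda>\<omega>. norm (partial_sum Xs k \<omega>) > t \<and> (\<forall>j\<in>{..<k}. norm (partial_sum Xs j \<omega>) \<le> t))"
    using partial_sum_measurable[OF assms] by measurable
  then show ?thesis by (simp add: first_exceed_def[abs_def] Ball_def)
qed

lemma partial_sum_diff: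
  fixes Xs :: "nat \<Rightarrow> 'a \<Rightarrow> 'b::ab_group_add"
  assumes "k \<le> n"
  shows "partial_sum Xs n \<omega> - partial_sum Xs k \<omega> = (\<Sum>i=k+1..n. Xs i \<omega>)"
proof -
  have "{1..n} = {1..k} \<union> {k+1..n}" using assms by auto
  moreover have "(\<Sum>i\<in>{1..k} \<union> {k+1..n}. Xs i \<omega>) = (\<Sum>i=1..k. Xs i \<omega>) + (\<Sum>i=k+1..n. Xs i \<omega>)"
    by (rule sum.union_disjoint) auto
  ultimately show ?thesis by (simp add: partial_sum_def)
qed

lemma partial_sum_flip_after:
  fixes Xs :: "nat \<Rightarrow> 'a \<Rightarrow> 'b::ab_group_add"
  shows "j \<le> k \<Longrightarrow> partial_sum (\<lambda>i \<omega>. if i \<in> {k<..} then - Xs i \<omega> else Xs i \<omega>) j \<omega> = partial_sum Xs j \<omega>"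
    and "k \<le> n \<Longrightarrow> partial_sum (\<lambda>i \<omega>. if i \<in> {k<..} then - Xs i \<omega> else Xs i \<omega>) n \<omega> =
      partial_sum Xs k \<omega> - (partial_sum Xs n \<omega> - partial_sum Xs k \<omega>)"
proof -
  let ?Y = "\<lambda>i \<omega>. if i \<in> {k<..} then - Xs i \<omega> else Xs i \<omega>"
  show *: "partial_sum ?Y j \<omega> = partial_sum Xs j \<omega>" if "j \<le> k" for j
    using that unfolding partial_sum_def by (intro sum.cong) auto
  show "partial_sum ?Y n \<omega> = partial_sum Xs k \<omega> - (partial_sum Xs n \<omega> - partial_sum Xs k \<omega>)"
    if "k \<le> n"
  proof -
    have "partial_sum ?Y n \<omega> = partial_sum ?Y k \<omega> + (\<Sum>i=k+1..n. ?Y i \<omega>)"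
      using partial_sum_diff[OF that, of ?Y \<omega>] by (simp add: algebra_simps)
    also have "(\<Sum>i=k+1..n. ?Y i \<omega>) = - (\<Sum>i=k+1..n. Xs i \<omega>)"
      unfolding sum_negf[symmetric] by (intro sum.cong) auto
    finally show ?thesis using *[of k] partial_sum_diff[OF that, of Xs \<omega>] by simp
  qed
qed

text \<open>Adding the original end point to this reflected one leaves twice the increment after
  time \<open>k\<close>. This is how increments are compared with the whole sum.\<close>

lemma partial_sum_flip_before:
  fixes Xs :: "nat \<Rightarrow> 'a \<Rightarrow> 'b::ab_group_add"
  assumes "k \<le> n"
  shows "partial_sum (\<lambda>i \<omega>. if i \<in> {..k} then - Xs i \<omega> else Xs i \<omega>) n \<omega> =
      (partial_sum Xs n \<omega> - partial_sum Xs k \<omega>) - partial_sum Xs k \<omega>"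
proof -
  let ?Y = "\<lambda>i \<omega>. if i \<in> {..k} then - Xs i \<omega> else Xs i \<omega>"
  have "partial_sum ?Y n \<omega> = partial_sum ?Y k \<omega> + (\<Sum>i=k+1..n. ?Y i \<omega>)"
    using partial_sum_diff[OF assms, of ?Y \<omega>] by (simp add: algebra_simps)
  also have "(\<Sum>i=k+1..n. ?Y i \<omega>) = (\<Sum>i=k+1..n. Xs i \<omega>)"
    by (intro sum.cong) auto
  also have "partial_sum ?Y k \<omega> = - partial_sum Xs k \<omega>"
    unfolding sum_negf[symmetric] partial_sum_def by (intro sum.cong) auto
  finally show ?thesis using partial_sum_diff[OF assms, of Xs \<omega>] by simp
qed

text \<open>
  Reflecting the summands after time \<open>k\<close> does not change the event of first passage at \<open>k\<close>, and
  the original and the reflected end point average to the partial sum at time \<open>k\<close>.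
\<close>

lemma sum_first_exceed_prob_le:
  fixes X :: "'a \<Rightarrow> 'b::{banach, second_countable_topology}"
  assumes X: "iid_sequence M X Xs" "symmetric_rv M X"
  shows "(\<Sum>k=1..n. measure M {\<omega> \<in> space M. first_exceed Xs t k \<omega>}) \<le>
    2 * measure M {\<omega> \<in> space M. norm (partial_sum Xs n \<omega>) > t}"
proof -
  note D = iid_sequenceD[OF X(1)]
  interpret prob_space M by (rule D)
  have [measurable]: "partial_sum Xs k \<in> borel_measurable M" for k
    by (rule partial_sum_measurable[OF X(1)])
  have [measurable]: "Measurable.pred M (first_exceed Xs t k)" for k
    by (rule first_exceed_measurable[OF X(1)])
  let ?E = "\<lambda>k. {\<omega> \<in> space M. first_exceed Xs t k \<omega> \<and> norm (partial_sum Xs n \<omega>) > t}"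
  have le: "measure M {\<omega> \<in> space M. first_exceed Xs t k \<omega>} \<le> 2 * measure M (?E k)"
    if k: "k \<in> {1..n}" for k
  proof -
    have kn: "k \<le> n" using k by simp
    \<comment> \<open>The joint event is written as a functional of the whole sequence so that the
      sign-flip identity applies to it.\<close>
    define h :: "(nat \<Rightarrow> 'b) \<Rightarrow> real" where
      "h x = of_bool ((norm (\<Sum>i=1..k. x i) > t \<and> (\<forall>j\<in>{..<k}. norm (\<Sum>i=1..j. x i) \<le> t)) \<and>
        norm (\<Sum>i=1..n. x i) > t)" for x
    have [measurable]: "(\<lambda>x. \<Sum>i=1..m. x i :: 'b) \<in> borel_measurable (PiM {1..} (\<lambda>_. borel))" for m
      by (intro borel_measurable_sum measurable_component_singleton) auto
    have h: "h \<in> borel_measurable (PiM {1..} (\<lambda>_. borel))"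
      unfolding h_def by measurable
    have hY: "h (\<lambda>i\<in>{1..}. Y i \<omega>) =
        of_bool (first_exceed Y t k \<omega> \<and> norm (partial_sum Y n \<omega>) > t)" for Y \<omega>
      by (simp add: h_def first_exceed_def partial_sum_def Ball_def)
    let ?Y = "\<lambda>i \<omega>. if i \<in> {k<..} then - Xs i \<omega> else Xs i \<omega>"
    have Y: "first_exceed ?Y t k \<omega> \<longleftrightarrow> first_exceed Xs t k \<omega>" for \<omega>
      using partial_sum_flip_after(1)[of _ k Xs \<omega>] by (simp add: first_exceed_def)
    have Ym: "partial_sum ?Y n \<in> borel_measurable M"
      by (rule partial_sum_measurable[OF iid_sequence_flip[OF X]])
    have S: "partial_sum Xs n \<in> borel_measurable M" by measurable
    have int: "integrable M (\<lambda>\<omega>. of_bool (first_exceed Xs t k \<omega> \<and> norm (Z \<omega>) > t) :: real)"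
      if [measurable]: "Z \<in> borel_measurable M" for Z :: "'a \<Rightarrow> 'b"
      by (rule integrable_const_bound[where B=1]) auto
    have int': "integrable M (\<lambda>\<omega>. of_bool (first_exceed ?Y t k \<omega> \<and> norm (Z \<omega>) > t) :: real)"
      if "Z \<in> borel_measurable M" for Z :: "'a \<Rightarrow> 'b"
      using int[OF that] unfolding Y .
    have exceed: "norm (partial_sum Xs n \<omega>) > t \<or> norm (partial_sum ?Y n \<omega>) > t"
      if "first_exceed Xs t k \<omega>" for \<omega>
    proof -
      have "partial_sum Xs n \<omega> + partial_sum ?Y n \<omega> = 2 *\<^sub>R partial_sum Xs k \<omega>"
        unfolding partial_sum_flip_after(2)[OF kn] by (simp add: scaleR_2)
      then have "2 * norm (partial_sum Xs k \<omega>) \<le> norm (partial_sum Xs n \<omega>) + norm (partial_sum ?Y n \<omega>)"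
        using norm_triangle_ineq[of "partial_sum Xs n \<omega>" "partial_sum ?Y n \<omega>"] by simp
      moreover have "norm (partial_sum Xs k \<omega>) > t" using that by (simp add: first_exceed_def)
      ultimately show ?thesis by linarith
    qed
    have "measure M {\<omega> \<in> space M. first_exceed Xs t k \<omega>} = (\<integral>\<omega>. of_bool (first_exceed Xs t k \<omega>) \<partial>M)"
      by (rule measure_eq_integral_of_bool)
    also have "\<dots> \<le> (\<integral>\<omega>. of_bool (first_exceed Xs t k \<omega> \<and> norm (partial_sum Xs n \<omega>) > t) +
        of_bool (first_exceed ?Y t k \<omega> \<and> norm (partial_sum ?Y n \<omega>) > t) \<partial>M)"
    proof (rule integral_mono)
      show "integrable M (\<lambda>\<omega>. of_bool (first_exceed Xs t k \<omega>) :: real)"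
        by (rule integrable_const_bound[where B=1]) auto
      show "integrable M (\<lambda>\<omega>. of_bool (first_exceed Xs t k \<omega> \<and> norm (partial_sum Xs n \<omega>) > t) +
        of_bool (first_exceed ?Y t k \<omega> \<and> norm (partial_sum ?Y n \<omega>) > t) :: real)"
        by (intro Bochner_Integration.integrable_add int[OF S] int'[OF Ym])
      show "of_bool (first_exceed Xs t k \<omega>) \<le>
        of_bool (first_exceed Xs t k \<omega> \<and> norm (partial_sum Xs n \<omega>) > t) +
        (of_bool (first_exceed ?Y t k \<omega> \<and> norm (partial_sum ?Y n \<omega>) > t) :: real)" for \<omega>
      proof (cases "first_exceed Xs t k \<omega>")
        case True
        from exceed[OF True] show ?thesis unfolding Y
          by (elim disjE) (simp_all only: True of_bool_eq simp_thms, simp_all)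
      qed (simp add: Y[simplified])
    qed
    also have "\<dots> = (\<integral>\<omega>. of_bool (first_exceed Xs t k \<omega> \<and> norm (partial_sum Xs n \<omega>) > t) \<partial>M) +
        (\<integral>\<omega>. of_bool (first_exceed ?Y t k \<omega> \<and> norm (partial_sum ?Y n \<omega>) > t) \<partial>M)"
      by (intro Bochner_Integration.integral_add int[OF S] int'[OF Ym])
    also have "\<dots> = measure M (?E k) + measure M (?E k)"
      using symmetric_integral_flip[OF X h, of "{k<..}"]
      unfolding hY[of ?Y] hY[of Xs] measure_eq_integral_of_bool by simp
    finally show ?thesis by simp
  qed
  have "(\<Sum>k=1..n. measure M {\<omega> \<in> space M. first_exceed Xs t k \<omega>}) \<le> (\<Sum>k=1..n. 2 * measure M (?E k))"
    by (intro sum_mono le)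
  \<comment> \<open>First passage happens at no more than one time, so the events are disjoint and
    all lie in the event that the end point exceeds \<open>t\<close>.\<close>
  also have "\<dots> = 2 * measure M (\<Union>k\<in>{1..n}. ?E k)"
    by (subst finite_measure_finite_Union)
      (auto simp: disjoint_family_on_def sum_distrib_left dest: first_exceed_unique)
  also have "\<dots> \<le> 2 * measure M {\<omega> \<in> space M. norm (partial_sum Xs n \<omega>) > t}"
    by (intro mult_left_mono finite_measure_mono) auto
  finally show ?thesis .
qed

text \<open>If some partial sum exceeds \<open>t\<close>, there is a first passage at some time
  \<open>k \<le> n\<close>; the bound on the summed first passage probabilities does the
  rest.\<close>

lemma Levy_maximal_inequality:
  fixes X :: "'a \<Rightarrow> 'b::{banach, second_countable_topology}"
  assumes X: "iid_sequence M X Xs" "symmetric_rv M X" and "t \<ge> 0"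
  shows "measure M {\<omega> \<in> space M. \<exists>k\<in>{1..n}. norm (partial_sum Xs k \<omega>) > t} \<le>
    2 * measure M {\<omega> \<in> space M. norm (partial_sum Xs n \<omega>) > t}"
proof -
  note D = iid_sequenceD[OF X(1)]
  interpret prob_space M by (rule D)
  have [measurable]: "Measurable.pred M (first_exceed Xs t k)" for k
    by (rule first_exceed_measurable[OF X(1)])
  have "measure M {\<omega> \<in> space M. \<exists>k\<in>{1..n}. norm (partial_sum Xs k \<omega>) > t} \<le>
      measure M (\<Union>k\<in>{1..n}. {\<omega> \<in> space M. first_exceed Xs t k \<omega>})"
  proof (rule finite_measure_mono)
    show "{\<omega> \<in> space M. \<exists>k\<in>{1..n}. norm (partial_sum Xs k \<omega>) > t} \<subseteq>
        (\<Union>k\<in>{1..n}. {\<omega> \<in> space M. first_exceed Xs t k \<omega>})"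
    proof safe
      fix \<omega> m
      assume \<omega>: "\<omega> \<in> space M" "m \<in> {1..n}" "norm (partial_sum Xs m \<omega>) > t"
      obtain k where "1 \<le> k" "k \<le> m" "first_exceed Xs t k \<omega>"
        by (rule first_exceed_ex[OF \<omega>(3) \<open>t \<ge> 0\<close>])
      with \<omega> show "\<omega> \<in> (\<Union>k\<in>{1..n}. {\<omega> \<in> space M. first_exceed Xs t k \<omega>})"
        by (intro UN_I[of k]) auto
    qed
  qed auto
  also have "\<dots> \<le> (\<Sum>k=1..n. measure M {\<omega> \<in> space M. first_exceed Xs t k \<omega>})"
    by (rule finite_measure_subadditive_finite) auto
  finally show ?thesis using sum_first_exceed_prob_le[OF X, of t n] by simp
qed

section \<open>The Hoffmann-Jorgensen inequality for bounded summands\<close>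

lemma norm_partial_sum_le:
  fixes Xs :: "nat \<Rightarrow> 'a \<Rightarrow> 'b::real_normed_vector"
  assumes "\<And>i. i \<ge> 1 \<Longrightarrow> norm (Xs i \<omega>) \<le> c"
  shows "norm (partial_sum Xs n \<omega>) \<le> n * c"
proof -
  have "norm (partial_sum Xs n \<omega>) \<le> (\<Sum>i=1..n. c)"
    unfolding partial_sum_def by (rule sum_norm_le) (use assms in auto)
  then show ?thesis by simp
qed

text \<open>Midpoint convexity of the positive part of \<open>norm x - s\<close>.\<close>

lemma pos_part_norm_convex:
  fixes u v :: "'b::real_normed_vector"
  assumes "2 *\<^sub>R w = u + v"
  shows "max 0 (norm w - s) \<le> (max 0 (norm u - s) + max 0 (norm v - s)) / 2"
proof -
  have "2 * norm w = norm (u + v)" using assms by (metis norm_scaleR abs_numeral)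
  then show ?thesis using norm_triangle_ineq[of u v] by (simp add: max_def)
qed

text \<open>A first passage at \<open>k\<close> is decided by the coordinates \<open>1..k\<close>
  and the increment by \<open>k+1..n\<close>, so the two are independent and the expectation
  factors.\<close>

lemma first_exceed_indep_increment:
  fixes X :: "'a \<Rightarrow> 'b::{banach, second_countable_topology}"
    and f :: "'b \<Rightarrow> real"
  assumes X: "iid_sequence M X Xs" and [measurable]: "f \<in> borel_measurable borel"
    and k: "1 \<le> k" "k \<le> n"
    and int: "integrable M (\<lambda>\<omega>. f (partial_sum Xs n \<omega> - partial_sum Xs k \<omega>))"
  shows "(\<integral>\<omega>. of_bool (first_exceed Xs t k \<omega>) * f (partial_sum Xs n \<omega> - partial_sum Xs k \<omega>) \<partial>M) =
      measure M {\<omega> \<in> space M. first_exceed Xs t k \<omega>} *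
      (\<integral>\<omega>. f (partial_sum Xs n \<omega> - partial_sum Xs k \<omega>) \<partial>M)" (is "?lhs = ?rhs")
    and "integrable M (\<lambda>\<omega>. of_bool (first_exceed Xs t k \<omega>) * f (partial_sum Xs n \<omega> - partial_sum Xs k \<omega>))"
      (is ?int)
proof -
  note D = iid_sequenceD[OF X]
  interpret prob_space M by (rule D)
  have [measurable]: "Measurable.pred M (first_exceed Xs t k)"
    by (rule first_exceed_measurable[OF X])
  \<comment> \<open>Summing over \<open>{1..k}\<inter>{..j}\<close> keeps the functional on the
    coordinates \<open>1..k\<close> for every \<open>j\<close>, which gives measurability on that
    finite product; for \<open>j < k\<close> the sum is the usual one.\<close>
  define h1 :: "(nat \<Rightarrow> 'b) \<Rightarrow> real" where
    "h1 x = of_bool (norm (\<Sum>i=1..k. x i) > t \<and> (\<forall>j\<in>{..<k}. norm (\<Sum>i\<in>{1..k}\<inter>{..j}. x i) \<le> t))" for x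
  define h2 :: "(nat \<Rightarrow> 'b) \<Rightarrow> real" where "h2 x = f (\<Sum>i=k+1..n. x i)" for x
  have [measurable]: "(\<lambda>x. \<Sum>i\<in>I. x i :: 'b) \<in> borel_measurable (PiM J (\<lambda>_. borel))" if "I \<subseteq> J" for I J :: "nat set"
    using that by (intro borel_measurable_sum measurable_component_singleton) auto
  have "indep_var borel (h1 \<circ> (\<lambda>\<omega>. restrict (\<lambda>i. Xs i \<omega>) {1..k})) borel (h2 \<circ> (\<lambda>\<omega>. restrict (\<lambda>i. Xs i \<omega>) {k+1..n}))"
  proof (rule indep_var_compose[OF indep_var_restrict[OF D(3)]])
    have [measurable]: "(\<lambda>x. \<Sum>i\<in>{1..k}\<inter>{..j}. x i :: 'b) \<in> borel_measurable (PiM {1..k} (\<lambda>_. borel))" for j :: nat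
      by (intro borel_measurable_sum measurable_component_singleton) auto
    show "h1 \<in> borel_measurable (PiM {1..k} (\<lambda>_. borel))" unfolding h1_def by measurable
    show "h2 \<in> borel_measurable (PiM {k+1..n} (\<lambda>_. borel))" unfolding h2_def by measurable
  qed (use k in auto)
  moreover have "(h1 \<circ> (\<lambda>\<omega>. restrict (\<lambda>i. Xs i \<omega>) {1..k})) = (\<lambda>\<omega>. of_bool (first_exceed Xs t k \<omega>))"
  proof
    fix \<omega>
    have "(\<Sum>i\<in>{1..k}\<inter>{..j}. restrict (\<lambda>i. Xs i \<omega>) {1..k} i) = partial_sum Xs j \<omega>" if "j < k" for j
      unfolding partial_sum_def using that by (intro sum.cong) auto
    moreover have "(\<Sum>i=1..k. restrict (\<lambda>i. Xs i \<omega>) {1..k} i) = partial_sum Xs k \<omega>"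
      unfolding partial_sum_def by (intro sum.cong) auto
    ultimately show "(h1 \<circ> (\<lambda>\<omega>. restrict (\<lambda>i. Xs i \<omega>) {1..k})) \<omega> = of_bool (first_exceed Xs t k \<omega>)"
      unfolding h1_def first_exceed_def comp_def by (auto simp del: of_bool_eq_iff intro!: arg_cong[where f=of_bool])
  qed
  moreover have "(h2 \<circ> (\<lambda>\<omega>. restrict (\<lambda>i. Xs i \<omega>) {k+1..n})) = (\<lambda>\<omega>. f (partial_sum Xs n \<omega> - partial_sum Xs k \<omega>))"
  proof
    fix \<omega>
    have "(\<Sum>i=k+1..n. restrict (\<lambda>i. Xs i \<omega>) {k+1..n} i) = (\<Sum>i=k+1..n. Xs i \<omega>)"
      by (intro sum.cong) auto
    then show "(h2 \<circ> (\<lambda>\<omega>. restrict (\<lambda>i. Xs i \<omega>) {k+1..n})) \<omega> = f (partial_sum Xs n \<omega> - partial_sum Xs k \<omega>)"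
      unfolding h2_def comp_def partial_sum_diff[OF k(2)] by simp
  qed
  ultimately have ind: "indep_var borel (\<lambda>\<omega>. of_bool (first_exceed Xs t k \<omega>) :: real) borel
      (\<lambda>\<omega>. f (partial_sum Xs n \<omega> - partial_sum Xs k \<omega>))"
    by simp
  have i1: "integrable M (\<lambda>\<omega>. of_bool (first_exceed Xs t k \<omega>) :: real)"
    by (rule integrable_const_bound[where B=1]) auto
  show "?lhs = ?rhs"
    using indep_var_lebesgue_integral[OF ind i1 int]
    unfolding measure_eq_integral_of_bool .
  show ?int by (rule indep_var_integrable[OF ind i1 int])
qed

text \<open>The increment is the midpoint of the end point and of the end point with the first
  \<open>k\<close> signs flipped. Both have the same law by symmetry, so convexity gives the
  bound.\<close>

lemma pos_part_partial_sum_integral_le: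
  fixes X :: "'a \<Rightarrow> 'b::{banach, second_countable_topology}"
  assumes X: "iid_sequence M X Xs" "symmetric_rv M X" and k: "k \<le> n" 
    and int: "integrable M (\<lambda>\<omega>. max 0 (norm (partial_sum Xs n \<omega>) - s))"
  shows "integrable M (\<lambda>\<omega>. max 0 (norm (partial_sum Xs n \<omega> - partial_sum Xs k \<omega>) - s))"
    and "(\<integral>\<omega>. max 0 (norm (partial_sum Xs n \<omega> - partial_sum Xs k \<omega>) - s) \<partial>M) \<le>
      (\<integral>\<omega>. max 0 (norm (partial_sum Xs n \<omega>) - s) \<partial>M)"
proof -
  note D = iid_sequenceD[OF X(1)]
  interpret prob_space M by (rule D)
  let ?Y = "\<lambda>i \<omega>. if i \<in> {..k} then - Xs i \<omega> else Xs i \<omega>"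
  note Y = iid_sequence_flip[OF X, of "{..k}"]
  have [measurable]: "partial_sum Xs j \<in> borel_measurable M" for j
    by (rule partial_sum_measurable[OF X(1)])
  have Ym: "partial_sum ?Y n \<in> borel_measurable M"
    by (rule partial_sum_measurable[OF Y])
  let ?f = "\<lambda>x::'b. max 0 (norm x - s)"
  have f: "?f \<in> borel_measurable borel" by measurable
  have law: "distr M borel (partial_sum ?Y n) = distr M borel (partial_sum Xs n)"
    by (rule iid_sequence_partial_sum_distr_eq[OF Y X(1) refl])
  have intY: "integrable M (\<lambda>\<omega>. ?f (partial_sum ?Y n \<omega>))"
    and eq: "(\<integral>\<omega>. ?f (partial_sum ?Y n \<omega>) \<partial>M) = (\<integral>\<omega>. ?f (partial_sum Xs n \<omega>) \<partial>M)"
    using integral_distr_cong[OF law _ _ f] Ym int by auto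
  have conv: "?f (partial_sum Xs n \<omega> - partial_sum Xs k \<omega>) \<le>
      (?f (partial_sum Xs n \<omega>) + ?f (partial_sum ?Y n \<omega>)) / 2" for \<omega>
    by (rule pos_part_norm_convex, subst partial_sum_flip_before[OF k]) (simp add: scaleR_2)
  have int2: "integrable M (\<lambda>\<omega>. (?f (partial_sum Xs n \<omega>) + ?f (partial_sum ?Y n \<omega>)) / 2)"
    using int intY by auto
  show 1: "integrable M (\<lambda>\<omega>. ?f (partial_sum Xs n \<omega> - partial_sum Xs k \<omega>))"
    by (rule Bochner_Integration.integrable_bound[OF int2]) (use conv in \<open>auto intro!: order_trans[OF _ abs_ge_self]\<close>)
  have "(\<integral>\<omega>. ?f (partial_sum Xs n \<omega> - partial_sum Xs k \<omega>) \<partial>M) \<le>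
      (\<integral>\<omega>. (?f (partial_sum Xs n \<omega>) + ?f (partial_sum ?Y n \<omega>)) / 2 \<partial>M)"
    by (rule integral_mono[OF 1 int2 conv])
  also have "\<dots> = (\<integral>\<omega>. ?f (partial_sum Xs n \<omega>) \<partial>M)"
    using int intY eq by simp
  finally show "(\<integral>\<omega>. ?f (partial_sum Xs n \<omega> - partial_sum Xs k \<omega>) \<partial>M) \<le> (\<integral>\<omega>. ?f (partial_sum Xs n \<omega>) \<partial>M)" .
qed

text \<open>
  Restarting the walk at its first passage over \<open>s\<close> gives
  \<open>E (\<parallel>S\<^sub>n\<parallel> - 2 s - c)\<^sup>+ \<le> 2 P(\<parallel>S\<^sub>n\<parallel> > s) E (\<parallel>S\<^sub>n\<parallel> - s)\<^sup>+\<close>, so half of \<open>E (\<parallel>S\<^sub>n\<parallel> - s)\<^sup>+\<close> can be absorbed.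
\<close>

lemma Hoffmann_Jorgensen_bounded:
  fixes X :: "'a \<Rightarrow> 'b::{banach, second_countable_topology}"
  assumes X: "iid_sequence M X Xs" "symmetric_rv M X"
    and bound: "\<And>i \<omega>. i \<ge> 1 \<Longrightarrow> norm (Xs i \<omega>) \<le> c"
    and s: "s \<ge> 0" and small: "measure M {\<omega> \<in> space M. norm (partial_sum Xs n \<omega>) > s} \<le> 1 / 4"
  shows "(\<integral>\<omega>. norm (partial_sum Xs n \<omega>) \<partial>M) \<le>
    s + 2 * (s + c) * measure M {\<omega> \<in> space M. norm (partial_sum Xs n \<omega>) > s}"
proof -
  note D = iid_sequenceD[OF X(1)]
  interpret prob_space M by (rule D)
  have [measurable]: "partial_sum Xs j \<in> borel_measurable M" for j
    by (rule partial_sum_measurable[OF X(1)])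
  have [measurable]: "Measurable.pred M (first_exceed Xs t k)" for t k
    by (rule first_exceed_measurable[OF X(1)])
  have c: "c \<ge> 0" using bound[of 1] norm_ge_zero order_trans by blast
  note Sn = norm_partial_sum_le[of Xs, OF bound]
  let ?f = "\<lambda>r x::'b. max 0 (norm x - r)"
  define G where "G = measure M {\<omega> \<in> space M. norm (partial_sum Xs n \<omega>) > s}"
  define J where "J r = (\<integral>\<omega>. ?f r (partial_sum Xs n \<omega>) \<partial>M)" for r
  have int: "integrable M (\<lambda>\<omega>. ?f r (partial_sum Xs n \<omega>))" if "r \<ge> 0" for r
  proof (rule integrable_const_bound[where B="n * c"])
    have "norm (?f r (partial_sum Xs n \<omega>)) \<le> n * c" for \<omega>
      using Sn[where n=n and \<omega>=\<omega>] that mult_nonneg_nonneg[OF of_nat_0_le_iff c, of n] by simp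
    then show "AE \<omega> in M. norm (?f r (partial_sum Xs n \<omega>)) \<le> n * c" by simp
  qed measurable
  have int1: "integrable M (\<lambda>\<omega>. norm (partial_sum Xs n \<omega>))"
    by (rule integrable_const_bound[where B="n * c"]) (use Sn[where n=n] in auto)
  have intG: "integrable M (\<lambda>\<omega>. of_bool (norm (partial_sum Xs n \<omega>) > s) :: real)"
    by (rule integrable_const_bound[where B=1]) auto
  have J0: "J s \<ge> 0" unfolding J_def by (rule integral_nonneg_AE) auto
  let ?g = "\<lambda>k \<omega>. of_bool (first_exceed Xs s k \<omega>) * ?f s (partial_sum Xs n \<omega> - partial_sum Xs k \<omega>)"
  have k: "(\<integral>\<omega>. ?g k \<omega> \<partial>M) \<le> measure M {\<omega> \<in> space M. first_exceed Xs s k \<omega>} * J s" "integrable M (?g k)"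
    if "k \<in> {1..n}" for k
  proof -
    have kn: "1 \<le> k" "k \<le> n" using that by auto
    note p = pos_part_partial_sum_integral_le[OF X kn(2) int[OF s]]
    have f: "?f s \<in> borel_measurable borel" by measurable
    note q = first_exceed_indep_increment[OF X(1) f kn p(1), of s]
    show "integrable M (?g k)" by (rule q)
    show "(\<integral>\<omega>. ?g k \<omega> \<partial>M) \<le> measure M {\<omega> \<in> space M. first_exceed Xs s k \<omega>} * J s"
      unfolding q(1) J_def by (intro mult_left_mono p) auto
  qed
  have "J (2 * s + c) \<le> (\<integral>\<omega>. (\<Sum>k=1..n. ?g k \<omega>) \<partial>M)"
    unfolding J_def
  proof (rule integral_mono)
    show "integrable M (\<lambda>\<omega>. ?f (2 * s + c) (partial_sum Xs n \<omega>))" using s c by (intro int) auto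
    show "integrable M (\<lambda>\<omega>. \<Sum>k=1..n. ?g k \<omega>)" using k by (intro Bochner_Integration.integrable_sum) auto
    fix \<omega>
    have nn: "(\<Sum>k=1..n. ?g k \<omega>) \<ge> 0" by (intro sum_nonneg) auto
    show "?f (2 * s + c) (partial_sum Xs n \<omega>) \<le> (\<Sum>k=1..n. ?g k \<omega>)"
    proof (cases "norm (partial_sum Xs n \<omega>) > 2 * s + c")
      case True
      then have "norm (partial_sum Xs n \<omega>) > s" using s c by simp
      then obtain k where k: "1 \<le> k" "k \<le> n" and e: "first_exceed Xs s k \<omega>"
        by (rule first_exceed_ex[OF _ s])
      \<comment> \<open>Just before the passage the norm is at most \<open>s\<close>, and one step
        adds at most \<open>c\<close>, so the walk lands within \<open>s + c\<close>. Whatever the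
        end point has beyond \<open>2 * s + c\<close>, the later increment must have beyond
        \<open>s\<close>.\<close>
      have "partial_sum Xs k \<omega> = partial_sum Xs (k - 1) \<omega> + Xs k \<omega>"
        using k(1) by (cases k) (simp_all add: partial_sum_def)
      moreover have "norm (partial_sum Xs (k - 1) \<omega>) \<le> s" using e k by (auto simp: first_exceed_def)
      moreover note bound[OF k(1), of \<omega>]
      ultimately have "norm (partial_sum Xs k \<omega>) \<le> s + c"
        by (metis add_mono norm_triangle_ineq order_trans)
      then have "?f (2 * s + c) (partial_sum Xs n \<omega>) \<le> ?g k \<omega>"
        using e norm_triangle_ineq2[of "partial_sum Xs n \<omega>" "partial_sum Xs k \<omega>"] by simp
      also have "\<dots> \<le> (\<Sum>k=1..n. ?g k \<omega>)" using k by (intro member_le_sum) auto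
      finally show ?thesis .
    qed (use nn in simp)
  qed
  also have "\<dots> = (\<Sum>k=1..n. (\<integral>\<omega>. ?g k \<omega> \<partial>M))"
    using k by (intro Bochner_Integration.integral_sum) auto
  also have "\<dots> \<le> (\<Sum>k=1..n. measure M {\<omega> \<in> space M. first_exceed Xs s k \<omega>} * J s)"
    by (intro sum_mono k)
  also have "\<dots> \<le> 2 * G * J s"
    unfolding sum_distrib_right[symmetric] G_def using J0
    by (intro mult_right_mono sum_first_exceed_prob_le[OF X]) auto
  finally have "J (2 * s + c) \<le> 2 * G * J s" .
  also have "\<dots> \<le> J s / 2" using mult_right_mono[OF small J0] by (simp add: G_def)
  finally have half: "J (2 * s + c) \<le> J s / 2" .
  \<comment> \<open>Above level \<open>s\<close> the excess is at most \<open>s + c\<close> plus the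
    excess over \<open>2 * s + c\<close>. Together with \<open>half\<close> this bounds
    \<open>J s\<close> by \<open>(s + c) * G + J s / 2\<close>, and the last term is
    absorbed.\<close>
  have "J s \<le> (\<integral>\<omega>. (s + c) * of_bool (norm (partial_sum Xs n \<omega>) > s) + ?f (2 * s + c) (partial_sum Xs n \<omega>) \<partial>M)"
    unfolding J_def using s c by (intro integral_mono int Bochner_Integration.integrable_add integrable_mult_right intG) auto
  also have "\<dots> = (s + c) * G + J (2 * s + c)"
    unfolding J_def G_def measure_eq_integral_of_bool using s c intG int[of "2 * s + c"] by simp
  finally have "J s \<le> 2 * ((s + c) * G)" using half by linarith
  moreover have "(\<integral>\<omega>. norm (partial_sum Xs n \<omega>) \<partial>M) \<le> (\<integral>\<omega>. s + ?f s (partial_sum Xs n \<omega>) \<partial>M)"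
    by (rule integral_mono) (use int1 int[OF s] in auto)
  moreover have "\<dots> = s + J s" unfolding J_def using int[OF s] by (simp add: prob_space)
  ultimately show ?thesis unfolding G_def mult.assoc by linarith
qed

section \<open>The contraction principle and a Jensen inequality\<close>

lemma partial_sum_remove:
  fixes Xs :: "nat \<Rightarrow> 'a \<Rightarrow> 'b::ab_group_add"
  assumes "1 \<le> m" "m \<le> n"
  shows "partial_sum Xs n \<omega> = Xs m \<omega> + (\<Sum>i\<in>{1..n} - {m}. Xs i \<omega>)"
  unfolding partial_sum_def by (rule sum.remove) (use assms in auto)

lemma norm_scaleR_contraction:
  fixes r u :: "'b::real_normed_vector"
  assumes "0 \<le> k" "k \<le> 1"
  shows "norm (k *\<^sub>R u + r) \<le> (1 + k) / 2 * norm (u + r) + (1 - k) / 2 * norm (- u + r)"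
proof -
  have "k *\<^sub>R u + r = ((1 + k) / 2) *\<^sub>R (u + r) + ((1 - k) / 2) *\<^sub>R (- u + r)"
  proof -
    have "p *\<^sub>R (u + r) + q *\<^sub>R (- u + r) = (p - q) *\<^sub>R u + (p + q) *\<^sub>R r" for p q
      by (simp add: algebra_simps)
    moreover have "(1 + k) / 2 - (1 - k) / 2 = k" "(1 + k) / 2 + (1 - k) / 2 = 1"
      by (simp_all add: field_simps)
    ultimately show ?thesis by simp
  qed
  also have "norm \<dots> \<le> norm (((1 + k) / 2) *\<^sub>R (u + r)) + norm (((1 - k) / 2) *\<^sub>R (- u + r))"
    by (rule norm_triangle_ineq)
  finally show ?thesis using assms by simp
qed

text \<open>
  The factors are inserted one coordinate at a time: \<open>k u + r\<close> is a convex combination of \<open>u + r\<close> and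
  \<open>- u + r\<close>, whose norms have the same weighted expectation by symmetry of that coordinate.
\<close>

lemma symmetric_contraction:
  fixes X :: "'a \<Rightarrow> 'b::{banach, second_countable_topology}"
    and g :: "'b \<Rightarrow> 'b" and \<kappa> :: "'b \<Rightarrow> real"
  assumes X: "iid_sequence M X Xs" "symmetric_rv M X"
    and g[measurable]: "g \<in> borel_measurable borel" and odd: "\<And>x. g (- x) = - g x"
    and bound: "\<And>x. norm (g x) \<le> c"
    and \<kappa>[measurable]: "\<kappa> \<in> borel_measurable borel" and even: "\<And>x. \<kappa> (- x) = \<kappa> x"
    and \<kappa>01: "\<And>x. 0 \<le> \<kappa> x" "\<And>x. \<kappa> x \<le> 1"
  shows "(\<integral>\<omega>. norm (partial_sum (\<lambda>i \<omega>. \<kappa> (Xs i \<omega>) *\<^sub>R g (Xs i \<omega>)) n \<omega>) \<partial>M) \<le>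
    (\<integral>\<omega>. norm (partial_sum (\<lambda>i \<omega>. g (Xs i \<omega>)) n \<omega>) \<partial>M)"
proof -
  note D = iid_sequenceD[OF X(1)]
  interpret prob_space M by (rule D)
  note [measurable] = D(4)
  have c: "c \<ge> 0" using bound[of 0] norm_ge_zero order_trans by blast
  \<comment> \<open>Interpolation between the two sums: the first \<open>k\<close> summands carry
    the factor, so \<open>T 0\<close> gives the right-hand side and \<open>T n\<close> the left-hand
    side.\<close>
  define T where "T k = (\<lambda>i \<omega>. if i \<le> k then \<kappa> (Xs i \<omega>) *\<^sub>R g (Xs i \<omega>) else g (Xs i \<omega>))" for k
  have \<kappa>gm: "(\<lambda>x. \<kappa> x *\<^sub>R g x) \<in> borel_measurable borel" by measurable
  have \<kappa>g: "norm (\<kappa> x *\<^sub>R g x) \<le> c" for x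
    using mult_mono[OF \<kappa>01(2) bound[of x]] \<kappa>01[of x] c by simp
  have Tb: "norm (T k i \<omega>) \<le> c" for k i \<omega>
    using \<kappa>g bound by (simp add: T_def)
  have Tm: "T k i \<in> borel_measurable M" if "i \<ge> 1" for k i
    unfolding T_def
    using measurable_compose[OF D(4)[OF that] \<kappa>gm] measurable_compose[OF D(4)[OF that] g]
    by (cases "i \<le> k") simp_all
  have int: "integrable M (\<lambda>\<omega>. norm (partial_sum (T k) n \<omega>))" for k
  proof (rule integrable_const_bound[where B="n * c"])
    show "AE \<omega> in M. norm (norm (partial_sum (T k) n \<omega>)) \<le> n * c"
      using norm_partial_sum_le[of "T k" _ c n] Tb by simp
    show "(\<lambda>\<omega>. norm (partial_sum (T k) n \<omega>)) \<in> borel_measurable M"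
      unfolding partial_sum_def
      by (rule measurable_compose[OF borel_measurable_sum borel_measurable_norm]) (auto intro: Tm)
  qed
  have step: "(\<integral>\<omega>. norm (partial_sum (T (Suc k)) n \<omega>) \<partial>M) \<le> (\<integral>\<omega>. norm (partial_sum (T k) n \<omega>) \<partial>M)"
    if "Suc k \<le> n" for k
  proof -
    let ?m = "Suc k"
    define r where "r x = (\<Sum>i\<in>{1..n} - {?m}. if i \<le> k then \<kappa> (x i) *\<^sub>R g (x i) else g (x i))" for x :: "nat \<Rightarrow> 'b"
    \<comment> \<open>The weighted norm to which the sign flip of coordinate \<open>?m\<close> is
      applied; \<open>r\<close> collects the other summands and does not see that
      coordinate.\<close>
    define h where "h x = (1 - \<kappa> (x ?m)) / 2 * norm (g (x ?m) + r x)" for x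
    have cm: "(\<lambda>x. x i) \<in> measurable (PiM {1..} (\<lambda>_. borel::'b measure)) borel" if "i \<ge> 1" for i :: nat
      using that by (intro measurable_component_singleton) auto
    have comp: "(\<lambda>x. f (x i)) \<in> measurable (PiM {1..} (\<lambda>_. borel::'b measure)) borel"
      if "f \<in> borel_measurable borel" "i \<ge> 1" for i :: nat and f :: "'b \<Rightarrow> 'c::topological_space"
      using measurable_compose[OF cm[OF that(2)] that(1)] .
    have rm: "r \<in> borel_measurable (PiM {1..} (\<lambda>_. borel))"
      unfolding r_def
    proof (intro borel_measurable_sum)
      fix i assume "i \<in> {1..n} - {?m}"
      then have "i \<ge> 1" by simp
      then show "(\<lambda>x. if i \<le> k then \<kappa> (x i) *\<^sub>R g (x i) else g (x i)) \<in> borel_measurable (PiM {1..} (\<lambda>_. borel))"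
        using comp[OF \<kappa>gm, of i] comp[OF g, of i]
          by (cases "i \<le> k") simp_all
    qed
    have h: "h \<in> borel_measurable (PiM {1..} (\<lambda>_. borel))"
      unfolding h_def using rm comp[OF \<kappa>, of ?m] comp[OF g, of ?m] by simp
    let ?\<kappa> = "\<lambda>\<omega>. \<kappa> (Xs ?m \<omega>)" and ?g = "\<lambda>\<omega>. g (Xs ?m \<omega>)" and ?r = "\<lambda>\<omega>. r (\<lambda>i. Xs i \<omega>)"
    have r1: "r (\<lambda>i\<in>{1..}. Xs i \<omega>) = ?r \<omega>" for \<omega>
      unfolding r_def by (intro sum.cong) auto
    have r2: "r (\<lambda>i\<in>{1..}. if i \<in> {?m} then - Xs i \<omega> else Xs i \<omega>) = ?r \<omega>" for \<omega>
      unfolding r_def by (intro sum.cong) auto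
    have T: "partial_sum (T k) n \<omega> = ?g \<omega> + ?r \<omega>"
      "partial_sum (T ?m) n \<omega> = ?\<kappa> \<omega> *\<^sub>R ?g \<omega> + ?r \<omega>" for \<omega>
    proof -
      have rest: "(\<Sum>i\<in>{1..n} - {?m}. T l i \<omega>) = ?r \<omega>" if "l = k \<or> l = ?m" for l
        using that unfolding r_def T_def by (intro sum.cong) auto
      have m: "T k ?m \<omega> = ?g \<omega>" "T ?m ?m \<omega> = ?\<kappa> \<omega> *\<^sub>R ?g \<omega>"
        by (simp_all add: T_def)
      show "partial_sum (T k) n \<omega> = ?g \<omega> + ?r \<omega>"
        using partial_sum_remove[of ?m n "T k" \<omega>] rest[of k] m that by simp
      show "partial_sum (T ?m) n \<omega> = ?\<kappa> \<omega> *\<^sub>R ?g \<omega> + ?r \<omega>"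
        using partial_sum_remove[of ?m n "T ?m" \<omega>] rest[of ?m] m that by simp
    qed
    have rM: "?r \<in> borel_measurable M"
      using measurable_compose[OF iid_sequence_restrict_measurable[OF X(1)] rm] unfolding r1 .
    have [measurable]: "Xs ?m \<in> borel_measurable M" by (rule D) simp
    have rb: "norm (?r \<omega>) \<le> n * c + c" for \<omega>
      using norm_triangle_ineq4[of "partial_sum (T k) n \<omega>" "?g \<omega>"] bound[of "Xs ?m \<omega>"]
        norm_partial_sum_le[of "T k" \<omega> c n, OF Tb] unfolding T by simp
    have i2: "integrable M (\<lambda>\<omega>. a (?\<kappa> \<omega>) * norm (b *\<^sub>R ?g \<omega> + ?r \<omega>))"
      if [measurable]: "a \<in> borel_measurable borel" and a: "\<And>u. 0 \<le> u \<Longrightarrow> u \<le> 1 \<Longrightarrow> \<bar>a u\<bar> \<le> 1" and "\<bar>b\<bar> = 1" for a b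
    proof (rule integrable_const_bound[where B="1 * (n * c + 2 * c)"])
      have "norm (b *\<^sub>R ?g \<omega> + ?r \<omega>) \<le> n * c + 2 * c" for \<omega>
        using norm_triangle_ineq[of "b *\<^sub>R ?g \<omega>" "?r \<omega>"] bound[of "Xs ?m \<omega>"] rb[of \<omega>] that by simp
      then have "norm (a (?\<kappa> \<omega>) * norm (b *\<^sub>R ?g \<omega> + ?r \<omega>)) \<le> 1 * (n * c + 2 * c)" for \<omega>
        using a[OF \<kappa>01, of "Xs ?m \<omega>"] unfolding norm_mult
        by (intro mult_mono) auto
      then show "AE \<omega> in M. norm (a (?\<kappa> \<omega>) * norm (b *\<^sub>R ?g \<omega> + ?r \<omega>)) \<le> 1 * (n * c + 2 * c)" by simp
    qed (use rM in measurable)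
    have iA: "integrable M (\<lambda>\<omega>. (1 + ?\<kappa> \<omega>) / 2 * norm (?g \<omega> + ?r \<omega>))"
      using i2[of "\<lambda>u. (1 + u) / 2" 1] by simp
    have iB: "integrable M (\<lambda>\<omega>. (1 - ?\<kappa> \<omega>) / 2 * norm (?g \<omega> + ?r \<omega>))"
      using i2[of "\<lambda>u. (1 - u) / 2" 1] by simp
    have iC: "integrable M (\<lambda>\<omega>. (1 - ?\<kappa> \<omega>) / 2 * norm (- ?g \<omega> + ?r \<omega>))"
      using i2[of "\<lambda>u. (1 - u) / 2" "-1"] by simp
    have "(\<integral>\<omega>. norm (partial_sum (T ?m) n \<omega>) \<partial>M) \<le>
        (\<integral>\<omega>. (1 + ?\<kappa> \<omega>) / 2 * norm (?g \<omega> + ?r \<omega>) + (1 - ?\<kappa> \<omega>) / 2 * norm (- ?g \<omega> + ?r \<omega>) \<partial>M)"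
      by (rule integral_mono[OF int Bochner_Integration.integrable_add[OF iA iC]])
        (unfold T, rule norm_scaleR_contraction[OF \<kappa>01])
    also have "\<dots> = (\<integral>\<omega>. (1 + ?\<kappa> \<omega>) / 2 * norm (?g \<omega> + ?r \<omega>) \<partial>M) +
        (\<integral>\<omega>. (1 - ?\<kappa> \<omega>) / 2 * norm (- ?g \<omega> + ?r \<omega>) \<partial>M)"
      by (rule Bochner_Integration.integral_add[OF iA iC])
    \<comment> \<open>Flipping coordinate \<open>?m\<close> fixes the even weight and the rest and
      reverses the odd \<open>g\<close>. Afterwards the two weights stand before the same norm and
      add up to 1.\<close>
    also have "(\<integral>\<omega>. (1 - ?\<kappa> \<omega>) / 2 * norm (- ?g \<omega> + ?r \<omega>) \<partial>M) =
        (\<integral>\<omega>. (1 - ?\<kappa> \<omega>) / 2 * norm (?g \<omega> + ?r \<omega>) \<partial>M)"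
      using symmetric_integral_flip[OF X h, of "{?m}"] unfolding h_def r1 r2 by (simp add: even odd)
    also have "(\<integral>\<omega>. (1 + ?\<kappa> \<omega>) / 2 * norm (?g \<omega> + ?r \<omega>) \<partial>M) + \<dots> =
        (\<integral>\<omega>. (1 + ?\<kappa> \<omega>) / 2 * norm (?g \<omega> + ?r \<omega>) + (1 - ?\<kappa> \<omega>) / 2 * norm (?g \<omega> + ?r \<omega>) \<partial>M)"
      by (rule Bochner_Integration.integral_add[OF iA iB, symmetric])
    also have "\<dots> = (\<integral>\<omega>. norm (partial_sum (T k) n \<omega>) \<partial>M)"
      unfolding T by (intro Bochner_Integration.integral_cong refl) (simp add: field_simps)
    finally show ?thesis .
  qed
  have "k \<le> n \<Longrightarrow> (\<integral>\<omega>. norm (partial_sum (T k) n \<omega>) \<partial>M) \<le> (\<integral>\<omega>. norm (partial_sum (T 0) n \<omega>) \<partial>M)" for k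
  proof (induction k)
    case (Suc k)
    then show ?case using step[of k] by simp
  qed simp
  moreover have "partial_sum (T n) n = partial_sum (\<lambda>i \<omega>. \<kappa> (Xs i \<omega>) *\<^sub>R g (Xs i \<omega>)) n"
    "partial_sum (T 0) n = partial_sum (\<lambda>i \<omega>. g (Xs i \<omega>)) n"
    unfolding partial_sum_def T_def by (auto intro!: sum.cong)
  ultimately show ?thesis by (metis order_refl)
qed

text \<open>Jensen's inequality with \<open>A\<close> held fixed: as \<open>B\<close> has mean zero,
  each value \<open>a\<close> of \<open>A\<close> is the mean of \<open>a - B\<close>. Independence
  turns the joint law into a product, and Fubini's theorem integrates over \<open>a\<close>.\<close>

lemma (in prob_space) expectation_norm_le_diff:
  fixes A B :: "'a \<Rightarrow> 'b::{banach, second_countable_topology}"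
  assumes ind: "indep_var borel A borel B" and A: "integrable M A" and B: "integrable M B"
    and B0: "(\<integral>\<omega>. B \<omega> \<partial>M) = 0"
  shows "(\<integral>\<omega>. norm (A \<omega>) \<partial>M) \<le> (\<integral>\<omega>. norm (A \<omega> - B \<omega>) \<partial>M)"
proof -
  have [measurable]: "A \<in> borel_measurable M" "B \<in> borel_measurable M" using A B by auto
  let ?A = "distr M borel A" and ?B = "distr M borel B"
  interpret A: prob_space ?A by (rule prob_space_distr) measurable
  interpret B: prob_space ?B by (rule prob_space_distr) measurable
  interpret AB: pair_sigma_finite ?A ?B ..
  have law: "?A \<Otimes>\<^sub>M ?B = distr M (borel \<Otimes>\<^sub>M borel) (\<lambda>\<omega>. (A \<omega>, B \<omega>))"
    using ind by (simp add: indep_var_distribution_eq)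
  have m: "(\<lambda>(a, b). norm (a - b)) \<in> borel_measurable (borel \<Otimes>\<^sub>M (borel :: 'b measure))" by measurable
  have int: "integrable (?A \<Otimes>\<^sub>M ?B) (\<lambda>(a, b). norm (a - b))"
    unfolding law using A B by (subst integrable_distr_eq[OF _ m]) auto
  have iB: "integrable ?B (\<lambda>b. b)" and iA: "integrable ?A (\<lambda>a. norm a)"
    using A B by (auto simp: integrable_distr_eq)
  have B0': "(\<integral>b. b \<partial>?B) = 0" using B0 by (subst integral_distr) auto
  have "(\<integral>\<omega>. norm (A \<omega>) \<partial>M) = (\<integral>a. norm a \<partial>?A)" by (subst integral_distr) auto
  also have "\<dots> \<le> (\<integral>a. (\<integral>b. norm (a - b) \<partial>?B) \<partial>?A)"
  proof (rule integral_mono[OF iA])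
    show "integrable ?A (\<lambda>a. \<integral>b. norm (a - b) \<partial>?B)"
      using AB.integrable_fst[OF int] by simp
    fix a :: 'b
    have "(\<integral>b. a - b \<partial>?B) = a" using iB B0' B.prob_space by simp
    then show "norm a \<le> (\<integral>b. norm (a - b) \<partial>?B)"
      using integral_norm_bound[of ?B "\<lambda>b. a - b"] by simp
  qed
  also have "\<dots> = (\<integral>p. (case p of (a, b) \<Rightarrow> norm (a - b)) \<partial>(?A \<Otimes>\<^sub>M ?B))"
    using AB.integral_fst[OF int] by simp
  also have "\<dots> = (\<integral>\<omega>. norm (A \<omega> - B \<omega>) \<partial>M)"
    unfolding law by (subst integral_distr[OF _ m]) auto
  finally show ?thesis .
qed

section \<open>Change of the norming sequence\<close>

lemma symmetric_rv_compose:
  fixes X :: "'a \<Rightarrow> 'b::{banach, second_countable_topology}" and f :: "'b \<Rightarrow> 'b"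
  assumes "symmetric_rv M X" and X[measurable]: "X \<in> borel_measurable M" and f: "f \<in> borel_measurable borel"
    and odd: "\<And>x. f (- x) = - f x"
  shows "symmetric_rv M (\<lambda>\<omega>. f (X \<omega>))"
  using distr_eq_compose[of M X M "\<lambda>\<omega>. - X \<omega>" f] assms by (simp add: symmetric_rv_def)

section \<open>Truncation, Markov's inequality and passage to L1 convergence\<close>

lemma iid_sequence_union_bound:
  assumes X: "iid_sequence M X Xs" and P: "Measurable.pred borel P"
  shows "measure M {\<omega> \<in> space M. \<exists>i\<in>{1..n}. P (Xs i \<omega>)} \<le> n * measure M {\<omega> \<in> space M. P (X \<omega>)}"
proof -
  note D = iid_sequenceD[OF X]
  interpret prob_space M by (rule D)
  have "{\<omega> \<in> space M. \<exists>i\<in>{1..n}. P (Xs i \<omega>)} = (\<Union>i\<in>{1..n}. {\<omega> \<in> space M. P (Xs i \<omega>)})" by auto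
  also have "measure M \<dots> \<le> (\<Sum>i=1..n. measure M {\<omega> \<in> space M. P (Xs i \<omega>)})"
    using measurable_compose[OF D(4) P] by (intro finite_measure_subadditive_finite) auto
  also have "\<dots> = (\<Sum>i=1..n. measure M {\<omega> \<in> space M. P (X \<omega>)})"
    by (intro sum.cong refl measure_distr_eq D P) auto
  finally show ?thesis by simp
qed

text \<open>Unless some summand satisfies \<open>P\<close> the two sums coincide, and the union
  bound prices that exception. With \<open>P\<close> saying that the norm exceeds
  \<open>b n\<close>, the price is the quantity assumed to vanish.\<close>

lemma partial_sum_truncation_bound:
  fixes X :: "'a \<Rightarrow> 'b::{banach, second_countable_topology}" and f g :: "'b \<Rightarrow> 'b"
  assumes X: "iid_sequence M X Xs" and P: "Measurable.pred borel P" and Q: "Measurable.pred borel Q"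
    and f: "f \<in> borel_measurable borel" and g: "g \<in> borel_measurable borel"
    and eq: "\<And>x. \<not> P x \<Longrightarrow> f x = g x"
  shows "measure M {\<omega> \<in> space M. Q (partial_sum (\<lambda>i \<omega>. f (Xs i \<omega>)) n \<omega>)} \<le>
    measure M {\<omega> \<in> space M. Q (partial_sum (\<lambda>i \<omega>. g (Xs i \<omega>)) n \<omega>)} + n * measure M {\<omega> \<in> space M. P (X \<omega>)}"
proof -
  note D = iid_sequenceD[OF X]
  interpret prob_space M by (rule D)
  have [measurable]: "partial_sum (\<lambda>i \<omega>. h (Xs i \<omega>)) n \<in> borel_measurable M"
    if "h \<in> borel_measurable borel" for h :: "'b \<Rightarrow> 'b"
    by (rule partial_sum_measurable[OF iid_sequence_compose[OF X that]])
  have mE: "{\<omega> \<in> space M. \<exists>i\<in>{1..n}. P (Xs i \<omega>)} \<in> sets M"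
    using measurable_compose[OF D(4) P] by (intro sets.sets_Collect_finite_Ex) auto
  have mQ: "{\<omega> \<in> space M. Q (partial_sum (\<lambda>i \<omega>. g (Xs i \<omega>)) n \<omega>)} \<in> sets M"
    using g Q by measurable
  have "measure M {\<omega> \<in> space M. Q (partial_sum (\<lambda>i \<omega>. f (Xs i \<omega>)) n \<omega>)} \<le>
    measure M ({\<omega> \<in> space M. Q (partial_sum (\<lambda>i \<omega>. g (Xs i \<omega>)) n \<omega>)} \<union>
      {\<omega> \<in> space M. \<exists>i\<in>{1..n}. P (Xs i \<omega>)})"
  proof (intro finite_measure_mono subsetI)
    fix \<omega> assume \<omega>: "\<omega> \<in> {\<omega> \<in> space M. Q (partial_sum (\<lambda>i \<omega>. f (Xs i \<omega>)) n \<omega>)}"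
    have "partial_sum (\<lambda>i \<omega>. f (Xs i \<omega>)) n \<omega> = partial_sum (\<lambda>i \<omega>. g (Xs i \<omega>)) n \<omega>"
      if "\<not> (\<exists>i\<in>{1..n}. P (Xs i \<omega>))"
      unfolding partial_sum_def using that by (intro sum.cong refl eq) auto
    with \<omega> show "\<omega> \<in> {\<omega> \<in> space M. Q (partial_sum (\<lambda>i \<omega>. g (Xs i \<omega>)) n \<omega>)} \<union>
      {\<omega> \<in> space M. \<exists>i\<in>{1..n}. P (Xs i \<omega>)}" by auto
  qed (use mE mQ in auto)
  also have "\<dots> \<le> measure M {\<omega> \<in> space M. Q (partial_sum (\<lambda>i \<omega>. g (Xs i \<omega>)) n \<omega>)} +
      measure M {\<omega> \<in> space M. \<exists>i\<in>{1..n}. P (Xs i \<omega>)}"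
    by (rule measure_Un_le[OF mQ mE])
  finally show ?thesis using iid_sequence_union_bound[OF X P, of n] by simp
qed

text \<open>Markov's inequality, the way back from L1 bounds to probabilities.\<close>

lemma (in prob_space) norm_tail_le_expectation:
  fixes Z :: "'a \<Rightarrow> 'b::{banach, second_countable_topology}"
  assumes "integrable M (\<lambda>\<omega>. norm (Z \<omega>))" "t > 0" "Z \<in> borel_measurable M"
  shows "prob {\<omega> \<in> space M. norm (Z \<omega>) > t} \<le> (\<integral>\<omega>. norm (Z \<omega>) \<partial>M) / t"
proof -
  have "t * prob {\<omega> \<in> space M. norm (Z \<omega>) > t} = (\<integral>\<omega>. t * of_bool (norm (Z \<omega>) > t) \<partial>M)"
    unfolding measure_eq_integral_of_bool by simp
  also have "\<dots> \<le> (\<integral>\<omega>. norm (Z \<omega>) \<partial>M)"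
  proof (rule integral_mono)
    show "integrable M (\<lambda>\<omega>. t * of_bool (norm (Z \<omega>) > t) :: real)"
      using assms(2,3) by (intro integrable_mult_right integrable_const_bound[where B=1]) auto
  qed (use assms in auto)
  finally show ?thesis using assms(2) by (simp add: field_simps)
qed

lemma integrable_norm_partial_sum_bounded:
  fixes X :: "'a \<Rightarrow> 'b::{banach, second_countable_topology}"
  assumes X: "iid_sequence M X Xs" and b: "\<And>i \<omega>. i \<ge> 1 \<Longrightarrow> norm (Xs i \<omega>) \<le> c"
  shows "integrable M (\<lambda>\<omega>. partial_sum Xs n \<omega>)" "integrable M (\<lambda>\<omega>. norm (partial_sum Xs n \<omega>))"
proof -
  interpret prob_space M by (rule iid_sequenceD[OF X])
  have "norm (partial_sum Xs n \<omega>) \<le> n * c" for \<omega>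
    by (rule norm_partial_sum_le) (rule b)
  then show "integrable M (\<lambda>\<omega>. partial_sum Xs n \<omega>)"
    using partial_sum_measurable[OF X] by (intro integrable_const_bound[where B="n * c"]) auto
  then show "integrable M (\<lambda>\<omega>. norm (partial_sum Xs n \<omega>))" by simp
qed

text \<open>The sequence may change with \<open>n\<close>, as truncation at a moving level requires.
  When the summands are bounded by the norming itself, the inequality at level
  \<open>s = \<delta> * c n\<close> upgrades convergence in probability to convergence of
  means.\<close>

lemma Hoffmann_Jorgensen_L1_convergence:
  fixes Y :: "nat \<Rightarrow> 'a \<Rightarrow> 'b::{banach, second_countable_topology}"
  assumes Y: "\<And>n. iid_sequence M (Y n) (Ys n)" "\<And>n. symmetric_rv M (Y n)"
    and bound: "\<And>n i \<omega>. n \<ge> 1 \<Longrightarrow> i \<ge> 1 \<Longrightarrow> norm (Ys n i \<omega>) \<le> c n"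
    and c: "\<And>n. n \<ge> 1 \<Longrightarrow> c n > 0"
    and lim: "\<And>\<epsilon>. \<epsilon> > 0 \<Longrightarrow>
      (\<lambda>n. measure M {\<omega> \<in> space M. norm (partial_sum (Ys n) n \<omega>) > \<epsilon> * c n}) \<longlonglongrightarrow> 0"
  shows "(\<lambda>n. (\<integral>\<omega>. norm (partial_sum (Ys n) n \<omega>) \<partial>M) / c n) \<longlonglongrightarrow> 0"
proof (rule LIMSEQ_I)
  fix \<epsilon> :: real assume "\<epsilon> > 0"
  \<comment> \<open>The bound \<open>1 / 4\<close> is what the inequality demands of the tail, and
    it makes \<open>\<delta> + 1\<close> at most \<open>5 / 4\<close>. The total is then at most
    \<open>7 / 2 * \<delta>\<close>, which is below
    \<open>6 * \<delta> \<le> \<epsilon>\<close>.\<close>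
  define \<delta> where "\<delta> = min (1 / 4) (\<epsilon> / 6)"
  have \<delta>: "\<delta> > 0" "\<delta> \<le> 1 / 4" "6 * \<delta> \<le> \<epsilon>" using \<open>\<epsilon> > 0\<close> by (auto simp: \<delta>_def)
  obtain N where N: "\<And>n. n \<ge> N \<Longrightarrow>
      measure M {\<omega> \<in> space M. norm (partial_sum (Ys n) n \<omega>) > \<delta> * c n} < \<delta>"
    using LIMSEQ_D[OF lim[OF \<delta>(1)] \<delta>(1)] by auto
  show "\<exists>N. \<forall>n\<ge>N. norm ((\<integral>\<omega>. norm (partial_sum (Ys n) n \<omega>) \<partial>M) / c n - 0) < \<epsilon>"
  proof (intro exI[of _ "max 1 N"] allI impI)
    fix n assume "n \<ge> max 1 N"
    then have n: "n \<ge> 1" "n \<ge> N" by auto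
    define G where "G = measure M {\<omega> \<in> space M. norm (partial_sum (Ys n) n \<omega>) > \<delta> * c n}"
    let ?I = "\<integral>\<omega>. norm (partial_sum (Ys n) n \<omega>) \<partial>M"
    have G: "G \<ge> 0" "G < \<delta>" using N[OF n(2)] by (auto simp: G_def)
    have "?I \<le> \<delta> * c n + 2 * (\<delta> * c n + c n) * G"
      unfolding G_def
      by (rule Hoffmann_Jorgensen_bounded[OF Y]) (use bound n c[OF n(1)] \<delta> G in \<open>auto simp: G_def intro!: mult_nonneg_nonneg less_imp_le[OF \<delta>(1)]\<close>)
    also have "\<dots> = (\<delta> + 2 * (\<delta> + 1) * G) * c n" by (simp add: algebra_simps)
    finally have "?I / c n \<le> \<delta> + 2 * (\<delta> + 1) * G" using c[OF n(1)] by (simp add: field_simps)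
    also have "\<dots> \<le> \<delta> + 2 * (5 / 4) * \<delta>" using \<delta> G by (intro add_left_mono mult_mono) auto
    also have "\<dots> < \<epsilon>" using \<delta> by simp
    finally have "?I / c n < \<epsilon>" .
    moreover have "?I / c n \<ge> 0" using c[OF n(1)] by simp
    ultimately show "norm (?I / c n - 0) < \<epsilon>" by simp
  qed
qed

text \<open>If \<open>t \<le> b n\<close>, the least index \<open>m t\<close> is at most
  \<open>n\<close>. Since \<open>a / b\<close> is nonincreasing this gives the lower bound on
  \<open>w\<close>, which later makes the contraction factor at most 1; since \<open>a\<close> is
  nondecreasing it gives \<open>w t * t \<le> a (m t) \<le> a n\<close>, which bounds the rescaled
  variable.\<close>

lemma comparison_weight:
  fixes a b :: "nat \<Rightarrow> real"
  assumes a: "\<And>n. n \<ge> 1 \<Longrightarrow> a n > 0" and b: "\<And>n. n \<ge> 1 \<Longrightarrow> b n > 0"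
    and mono: "mono_on {1..} a" and ratio: "mono_on {1..} (\<lambda>n. b n / a n)"
    and lim: "filterlim b at_top sequentially"
  obtains w :: "real \<Rightarrow> real" where "w \<in> borel_measurable borel" "\<And>t. w t > 0"
    "\<And>n t. n \<ge> 1 \<Longrightarrow> t \<le> b n \<Longrightarrow> a n / b n \<le> w t"
    "\<And>n t. n \<ge> 1 \<Longrightarrow> t \<le> b n \<Longrightarrow> w t * t \<le> a n"
proof -
  define m where "m t = (LEAST m. m \<ge> 1 \<and> b m \<ge> t)" for t
  have ex: "\<exists>m. m \<ge> 1 \<and> b m \<ge> t" for t
  proof -
    have "eventually (\<lambda>n. b n \<ge> t \<and> n \<ge> 1) sequentially"
      using lim unfolding filterlim_at_top by (intro eventually_conj eventually_ge_at_top) auto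
    then show ?thesis by (auto dest: eventually_happens)
  qed
  have m: "m t \<ge> 1" "b (m t) \<ge> t" for t using LeastI_ex[OF ex[of t]] by (auto simp: m_def)
  have mle: "m t \<le> n" if "n \<ge> 1" "t \<le> b n" for n t unfolding m_def using that by (intro Least_le) auto
  define w where "w t = a (m t) / b (m t)" for t
  have pos: "w t > 0" for t using a[OF m(1)] b[OF m(1)] by (simp add: w_def)
  have anti: "a n / b n \<le> a k / b k" if "1 \<le> k" "k \<le> n" for k n
  proof -
    have "b k / a k \<le> b n / a n" using mono_onD[OF ratio, of k n] that by simp
    then show ?thesis using a[of k] a[of n] b[of k] b[of n] that by (simp add: field_simps)
  qed
  have w1: "a n / b n \<le> w t" if "n \<ge> 1" "t \<le> b n" for n t
    unfolding w_def using anti[OF m(1) mle[OF that]] .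
  have w2: "w t * t \<le> a n" if "n \<ge> 1" "t \<le> b n" for n t
  proof -
    have "w t * t \<le> w t * b (m t)" using pos[of t] m(2)[of t] by (intro mult_left_mono) auto
    also have "\<dots> = a (m t)" using b[OF m(1), of t] by (simp add: w_def)
    also have "\<dots> \<le> a n" using mono_onD[OF mono, of "m t" n] m(1)[of t] mle[OF that] that(1) by simp
    finally show ?thesis .
  qed
  \<comment> \<open>The weight is nonincreasing, so its negative is monotone and therefore
    Borel.\<close>
  have "mono (\<lambda>t. - w t)"
  proof (rule monoI)
    fix s t :: real assume "s \<le> t"
    then have "m s \<le> m t" using m[of t] by (intro mle) auto
    then show "- w s \<le> - w t" unfolding w_def using anti[OF m(1)] by simp
  qed
  then have "(\<lambda>t. - (- w t)) \<in> borel_measurable borel"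
    by (intro borel_measurable_uminus borel_measurable_mono)
  then show ?thesis using that[of w] pos w1 w2 by simp
qed

text \<open>The chain runs from the law for \<open>y\<close> of the variables to its truncation
  \<open>u\<close>, to L1 convergence of the sums of \<open>u\<close>, by contraction to the
  truncation \<open>z\<close> of the variables themselves, and by Markov's inequality to the
  untruncated sums.\<close>

lemma symmetric_weak_law_comparison:
  fixes X :: "'a \<Rightarrow> 'b::{banach, second_countable_topology}" and a b :: "nat \<Rightarrow> real"
  assumes a: "\<And>n. n \<ge> 1 \<Longrightarrow> a n > 0" and b: "\<And>n. n \<ge> 1 \<Longrightarrow> b n > 0"
    and mono: "mono_on {1..} a" and ratio: "mono_on {1..} (\<lambda>n. b n / a n)"
    and lim: "filterlim b at_top sequentially"
    and wl: "symmetric_weak_law TYPE('b) a"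
    and X: "iid_sequence M X Xs" "symmetric_rv M X"
    and tail: "(\<lambda>n. real n * measure M {\<omega> \<in> space M. norm (X \<omega>) > b n}) \<longlonglongrightarrow> 0"
    and \<epsilon>: "\<epsilon> > 0"
  shows "(\<lambda>n. measure M {\<omega> \<in> space M. norm (partial_sum Xs n \<omega>) > \<epsilon> * b n}) \<longlonglongrightarrow> 0"
proof -
  note D = iid_sequenceD[OF X(1)]
  interpret prob_space M by (rule D)
  note [measurable] = D(2)
  obtain w where w[measurable]: "w \<in> borel_measurable borel" and wpos: "\<And>t. w t > 0"
    and w1: "\<And>n t. n \<ge> 1 \<Longrightarrow> t \<le> b n \<Longrightarrow> a n / b n \<le> w t"
    and w2: "\<And>n t. n \<ge> 1 \<Longrightarrow> t \<le> b n \<Longrightarrow> w t * t \<le> a n"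
    using comparison_weight[OF a b mono ratio lim] by blast
  \<comment> \<open>\<open>y\<close> is the rescaled vector, \<open>u n\<close> and
    \<open>z n\<close> are the truncations of \<open>y\<close> and of the identity at the same level
    \<open>norm x \<le> b n\<close>, and \<open>\<kappa> n\<close> is the even factor that leads
    from \<open>u n\<close> to a multiple of \<open>z n\<close>.\<close>
  define y where "y x = w (norm x) *\<^sub>R x" for x :: 'b
  define u where "u n x = (if norm x \<le> b n then y x else 0)" for n x
  define z where "z n x = (if norm x \<le> b n then x else 0)" for n and x :: 'b
  define \<kappa> where "\<kappa> n x = (if 1 \<le> n \<and> norm x \<le> b n then (a n / b n) / w (norm x) else 0)" for n and x :: 'b
  have y[measurable]: "y \<in> borel_measurable borel" unfolding y_def by measurable
  have u[measurable]: "u n \<in> borel_measurable borel" for n unfolding u_def by measurable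
  have z[measurable]: "z n \<in> borel_measurable borel" for n unfolding z_def by measurable
  have \<kappa>[measurable]: "\<kappa> n \<in> borel_measurable borel" for n unfolding \<kappa>_def by measurable
  have odd: "y (- x) = - y x" "u n (- x) = - u n x" for n x by (simp_all add: y_def u_def)
  have ny: "norm (y x) = w (norm x) * norm x" for x using wpos[of "norm x"] by (simp add: y_def)
  have yle: "norm (y x) \<le> a n" if "n \<ge> 1" "norm x \<le> b n" for n x
    unfolding ny using w2[OF that] .
  have ule: "norm (u n x) \<le> a n" if "n \<ge> 1" for n x
    using yle[OF that] a[OF that] by (simp add: u_def)
  let ?p = "\<lambda>n. real n * measure M {\<omega> \<in> space M. norm (X \<omega>) > b n}"
  have ytail: "(\<lambda>n. real n * measure M {\<omega> \<in> space M. norm (y (X \<omega>)) > a n}) \<longlonglongrightarrow> 0"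
  proof (rule tendsto_sandwich[OF _ _ tendsto_const tail])
    show "\<forall>\<^sub>F n in sequentially. real n * measure M {\<omega> \<in> space M. norm (y (X \<omega>)) > a n} \<le> ?p n"
      using eventually_ge_at_top[of 1]
    proof eventually_elim
      case (elim n)
      then show ?case using yle[OF elim]
        by (intro mult_left_mono finite_measure_mono) (auto simp: not_le[symmetric])
    qed
  qed simp
  have yconv: "(\<lambda>n. measure M {\<omega> \<in> space M. norm (partial_sum (\<lambda>i \<omega>. y (Xs i \<omega>)) n \<omega>) > \<delta> * a n}) \<longlonglongrightarrow> 0"
    if "\<delta> > 0" for \<delta>
    using symmetric_weak_lawD[OF wl iid_sequence_compose[OF X(1) y]
        symmetric_rv_compose[OF X(2) D(2) y odd(1)] ytail that a] .
  have uconv: "(\<lambda>n. measure M {\<omega> \<in> space M. norm (partial_sum (\<lambda>i \<omega>. u n (Xs i \<omega>)) n \<omega>) > \<delta> * a n}) \<longlonglongrightarrow> 0"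
    if "\<delta> > 0" for \<delta>
  proof (rule tendsto_sandwich[OF _ _ tendsto_const tendsto_add_zero[OF yconv[OF that] tail]])
    have "measure M {\<omega> \<in> space M. norm (partial_sum (\<lambda>i \<omega>. u n (Xs i \<omega>)) n \<omega>) > \<delta> * a n} \<le>
      measure M {\<omega> \<in> space M. norm (partial_sum (\<lambda>i \<omega>. y (Xs i \<omega>)) n \<omega>) > \<delta> * a n} + ?p n" for n
      by (rule partial_sum_truncation_bound[OF X(1) _ _ u y]) (auto simp: u_def)
    then show "\<forall>\<^sub>F n in sequentially. measure M {\<omega> \<in> space M. norm (partial_sum (\<lambda>i \<omega>. u n (Xs i \<omega>)) n \<omega>) > \<delta> * a n} \<le>
      measure M {\<omega> \<in> space M. norm (partial_sum (\<lambda>i \<omega>. y (Xs i \<omega>)) n \<omega>) > \<delta> * a n} + ?p n" by simp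
  qed simp
  have uL1: "(\<lambda>n. (\<integral>\<omega>. norm (partial_sum (\<lambda>i \<omega>. u n (Xs i \<omega>)) n \<omega>) \<partial>M) / a n) \<longlonglongrightarrow> 0"
    by (rule Hoffmann_Jorgensen_L1_convergence[where Y="\<lambda>n \<omega>. u n (X \<omega>)"])
      (use iid_sequence_compose[OF X(1) u] symmetric_rv_compose[OF X(2) D(2) u odd(2)] ule a uconv in auto)
  have zu: "(\<integral>\<omega>. norm (partial_sum (\<lambda>i \<omega>. z n (Xs i \<omega>)) n \<omega>) \<partial>M) / b n \<le>
      (\<integral>\<omega>. norm (partial_sum (\<lambda>i \<omega>. u n (Xs i \<omega>)) n \<omega>) \<partial>M) / a n" if n: "n \<ge> 1" for n
  proof -
    have ab: "a n > 0" "b n > 0" using a b n by auto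
    \<comment> \<open>The weight in \<open>\<kappa>\<close> cancels the one in \<open>y\<close>,
      leaving the deterministic ratio of the two norming sequences.\<close>
    have \<kappa>u: "\<kappa> n x *\<^sub>R u n x = (a n / b n) *\<^sub>R z n x" for x
      using n wpos[of "norm x"] by (simp add: \<kappa>_def u_def z_def y_def)
    have \<kappa>01: "0 \<le> \<kappa> n x" "\<kappa> n x \<le> 1" for x
      using w1[OF n, of "norm x"] wpos[of "norm x"] ab by (auto simp: \<kappa>_def pos_divide_le_eq simp del: divide_divide_eq_left)
    have "partial_sum (\<lambda>i \<omega>. \<kappa> n (Xs i \<omega>) *\<^sub>R u n (Xs i \<omega>)) n \<omega> =
        (a n / b n) *\<^sub>R partial_sum (\<lambda>i \<omega>. z n (Xs i \<omega>)) n \<omega>" for \<omega>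
      unfolding \<kappa>u partial_sum_def scaleR_sum_right ..
    then have "(a n / b n) * (\<integral>\<omega>. norm (partial_sum (\<lambda>i \<omega>. z n (Xs i \<omega>)) n \<omega>) \<partial>M) =
        (\<integral>\<omega>. norm (partial_sum (\<lambda>i \<omega>. \<kappa> n (Xs i \<omega>) *\<^sub>R u n (Xs i \<omega>)) n \<omega>) \<partial>M)"
      using ab by simp
    also have "\<dots> \<le> (\<integral>\<omega>. norm (partial_sum (\<lambda>i \<omega>. u n (Xs i \<omega>)) n \<omega>) \<partial>M)"
      by (rule symmetric_contraction[OF X u odd(2) ule[OF n] \<kappa> _ \<kappa>01]) (simp add: \<kappa>_def)
    finally show ?thesis using ab by (simp add: field_simps)
  qed
  have zL1: "(\<lambda>n. (\<integral>\<omega>. norm (partial_sum (\<lambda>i \<omega>. z n (Xs i \<omega>)) n \<omega>) \<partial>M) / b n) \<longlonglongrightarrow> 0"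
    by (rule tendsto_sandwich[OF _ _ tendsto_const uL1])
      (auto simp: eventually_at_top_linorder intro!: exI[of _ 1] zu divide_nonneg_pos b)
  let ?z = "\<lambda>n. (\<integral>\<omega>. norm (partial_sum (\<lambda>i \<omega>. z n (Xs i \<omega>)) n \<omega>) \<partial>M) / b n"
  have bnd: "(\<lambda>n. ?z n / \<epsilon> + ?p n) \<longlonglongrightarrow> 0"
    using tendsto_add[OF tendsto_divide[OF zL1 tendsto_const[of \<epsilon>]] tail] \<epsilon> by simp
  show ?thesis
  proof (rule tendsto_sandwich[OF _ _ tendsto_const bnd])
    show "\<forall>\<^sub>F n in sequentially. measure M {\<omega> \<in> space M. norm (partial_sum Xs n \<omega>) > \<epsilon> * b n} \<le> ?z n / \<epsilon> + ?p n"
      using eventually_ge_at_top[of 1]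
    proof eventually_elim
      case (elim n)
      have bn: "b n > 0" using b elim by simp
      have zb: "norm (z n x) \<le> b n" for x using bn by (simp add: z_def)
      note Z = iid_sequence_compose[OF X(1) z[of n]]
      have "measure M {\<omega> \<in> space M. norm (partial_sum Xs n \<omega>) > \<epsilon> * b n} \<le>
        measure M {\<omega> \<in> space M. norm (partial_sum (\<lambda>i \<omega>. z n (Xs i \<omega>)) n \<omega>) > \<epsilon> * b n} + ?p n"
        by (rule partial_sum_truncation_bound[OF X(1) _ _ _ z[of n], where f="\<lambda>x. x"]) (auto simp: z_def)
      also have "measure M {\<omega> \<in> space M. norm (partial_sum (\<lambda>i \<omega>. z n (Xs i \<omega>)) n \<omega>) > \<epsilon> * b n} \<le>
        (\<integral>\<omega>. norm (partial_sum (\<lambda>i \<omega>. z n (Xs i \<omega>)) n \<omega>) \<partial>M) / (\<epsilon> * b n)"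
        using \<epsilon> bn by (intro norm_tail_le_expectation integrable_norm_partial_sum_bounded[OF Z zb] partial_sum_measurable[OF Z]) auto
      finally show ?case by (simp add: field_simps)
    qed
  qed simp
qed

section \<open>Symmetrization and centering\<close>

lemma iid_sequence_max_tail:
  fixes X :: "'a \<Rightarrow> 'b::{banach, second_countable_topology}"
  assumes X: "iid_sequence M X Xs"
  shows "measure M {\<omega> \<in> space M. \<exists>i\<in>{1..n}. norm (Xs i \<omega>) > t} =
    1 - (1 - measure M {\<omega> \<in> space M. norm (X \<omega>) > t}) ^ n"
\<comment> \<open>The case of no summands is separate because an intersection over no indices would
  not be \<open>space M\<close>.\<close>
proof (cases "n = 0")
  case False
  note D = iid_sequenceD[OF X]
  interpret prob_space M by (rule D)
  let ?p = "measure M {\<omega> \<in> space M. norm (X \<omega>) > t}"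
  have p: "measure M {\<omega> \<in> space M. norm (Xs i \<omega>) > t} = ?p" if "i \<ge> 1" for i
    by (rule measure_distr_eq[OF D(5)[OF that] D(4)[OF that] D(2)]) measurable
  have m: "{\<omega> \<in> space M. norm (Xs i \<omega>) > t} \<in> sets M" if "i \<ge> 1" for i
    using D(4)[OF that] by measurable
  let ?E = "{\<omega> \<in> space M. \<exists>i\<in>{1..n}. norm (Xs i \<omega>) > t}"
  have mE: "?E \<in> sets M" using m by (intro sets.sets_Collect_finite_Ex) auto
  have "1 - measure M ?E = prob (space M - ?E)" using prob_compl[OF mE] by simp
  also have "space M - ?E = (\<Inter>i\<in>{1..n}. Xs i -` {x. norm x \<le> t} \<inter> space M)"
  proof (rule set_eqI)
    fix \<omega>
    have "(\<exists>i\<in>{1..n}. norm (Xs i \<omega>) > t) \<longleftrightarrow> \<not> (\<forall>i\<in>{1..n}. norm (Xs i \<omega>) \<le> t)"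
      by (simp only: bex_simps ball_simps not_le[symmetric] not_not Bex_def Ball_def) blast
    moreover have "1 \<in> {1..n}" using False by simp
    ultimately show "\<omega> \<in> space M - ?E \<longleftrightarrow> \<omega> \<in> (\<Inter>i\<in>{1..n}. Xs i -` {x. norm x \<le> t} \<inter> space M)"
      by blast
  qed
  also have "prob \<dots> = (\<Prod>i\<in>{1..n}. prob (Xs i -` {x. norm x \<le> t} \<inter> space M))"
    using False by (intro indep_varsD[OF D(3)]) auto
  also have "\<dots> = (\<Prod>i\<in>{1..n}. 1 - ?p)"
  proof (intro prod.cong refl)
    fix i assume "i \<in> {1..n}"
    then have i: "i \<ge> 1" by simp
    have "Xs i -` {x. norm x \<le> t} \<inter> space M = space M - {\<omega> \<in> space M. norm (Xs i \<omega>) > t}" by auto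
    then show "prob (Xs i -` {x. norm x \<le> t} \<inter> space M) = 1 - ?p"
      using prob_compl[OF m[OF i]] p[OF i] by simp
  qed
  finally show ?thesis by simp
qed simp

text \<open>Bernoulli's inequality replaces \<open>1 + n * p\<close> by a power, and the product of
  the two powers is a power of \<open>1 - p\<^sup>2\<close>. It serves to convert a small
  probability for the maximum of \<open>n\<close> variables into a small value of
  \<open>n * p\<close>.\<close>

lemma one_minus_power_bernoulli:
  fixes p :: real
  assumes "0 \<le> p" "p \<le> 1"
  shows "(1 - p) ^ n * (1 + n * p) \<le> 1"
proof -
  have "(1 - p) ^ n * (1 + n * p) \<le> (1 - p) ^ n * (1 + p) ^ n"
    using assms Bernoulli_inequality[of p n] by (intro mult_left_mono) auto
  also have "\<dots> = (1 - p\<^sup>2) ^ n"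
    unfolding power_mult_distrib[symmetric] by (simp add: algebra_simps power2_eq_square)
  also have "\<dots> \<le> 1" using assms by (intro power_le_one) (auto simp: power_le_one)
  finally show ?thesis .
qed

text \<open>A summand is a difference of consecutive partial sums, so one above
  \<open>2 * t n\<close> forces a partial sum above \<open>t n\<close>; Levy's inequality passes to
  the end point. The formula for the maximum then recovers the single tail.\<close>

lemma symmetric_tail_of_partial_sum:
  fixes X :: "'a \<Rightarrow> 'b::{banach, second_countable_topology}"
  assumes X: "iid_sequence M X Xs" "symmetric_rv M X" and t: "\<And>n. n \<ge> 1 \<Longrightarrow> t n \<ge> 0"
    and lim: "(\<lambda>n. measure M {\<omega> \<in> space M. norm (partial_sum Xs n \<omega>) > t n}) \<longlonglongrightarrow> 0"
  shows "(\<lambda>n. real n * measure M {\<omega> \<in> space M. norm (X \<omega>) > 2 * t n}) \<longlonglongrightarrow> 0"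
proof -
  note D = iid_sequenceD[OF X(1)]
  interpret prob_space M by (rule D)
  let ?G = "\<lambda>n. measure M {\<omega> \<in> space M. norm (partial_sum Xs n \<omega>) > t n}"
  let ?p = "\<lambda>n. measure M {\<omega> \<in> space M. norm (X \<omega>) > 2 * t n}"
  have [measurable]: "partial_sum Xs k \<in> borel_measurable M" for k
    by (rule partial_sum_measurable[OF X(1)])
  \<comment> \<open>One factor 2 comes from Levy's inequality; the other from
    \<open>1 - ?q \<ge> 1 / 2\<close>, which is where \<open>?G n \<le> 1 / 4\<close>
    enters.\<close>
  have *: "real n * ?p n \<le> 4 * ?G n" if n: "n \<ge> 1" and G: "?G n \<le> 1 / 4" for n
  proof -
    let ?q = "measure M {\<omega> \<in> space M. \<exists>i\<in>{1..n}. norm (Xs i \<omega>) > 2 * t n}"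
    have "?q \<le> measure M {\<omega> \<in> space M. \<exists>k\<in>{1..n}. norm (partial_sum Xs k \<omega>) > t n}"
    proof (intro finite_measure_mono subsetI)
      fix \<omega> assume "\<omega> \<in> {\<omega> \<in> space M. \<exists>i\<in>{1..n}. norm (Xs i \<omega>) > 2 * t n}"
      then obtain i where i: "\<omega> \<in> space M" "1 \<le> i" "i \<le> n" "norm (Xs i \<omega>) > 2 * t n" by auto
      then have "partial_sum Xs i \<omega> = partial_sum Xs (i - 1) \<omega> + Xs i \<omega>"
        by (cases i) (simp_all add: partial_sum_def)
      then have "norm (Xs i \<omega>) \<le> norm (partial_sum Xs i \<omega>) + norm (partial_sum Xs (i - 1) \<omega>)"
        using norm_triangle_ineq4[of "partial_sum Xs i \<omega>" "partial_sum Xs (i - 1) \<omega>"] by simp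
      with i(4) have or: "norm (partial_sum Xs i \<omega>) > t n \<or> norm (partial_sum Xs (i - 1) \<omega>) > t n"
        by linarith
      \<comment> \<open>For \<open>i = 1\<close> the preceding sum is empty and cannot exceed
        \<open>t n \<ge> 0\<close>, so the witness stays in \<open>{1..n}\<close>.\<close>
      have "i - 1 \<noteq> 0" if "norm (partial_sum Xs (i - 1) \<omega>) > t n"
      proof
        assume "i - 1 = 0"
        with that t[OF n] show False by (simp add: partial_sum_def)
      qed
      then have "\<exists>k\<in>{1..n}. norm (partial_sum Xs k \<omega>) > t n"
        using or i(2,3) by (elim disjE, intro bexI[of _ i]) (auto intro!: bexI[of _ "i - 1"])
      with i(1) show "\<omega> \<in> {\<omega> \<in> space M. \<exists>k\<in>{1..n}. norm (partial_sum Xs k \<omega>) > t n}" by simp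
    qed measurable
    also have "\<dots> \<le> 2 * ?G n" by (rule Levy_maximal_inequality[OF X t[OF n]])
    finally have q: "?q \<le> 2 * ?G n" .
    have "(1 - ?p n) ^ n * (1 + n * ?p n) \<le> 1" by (rule one_minus_power_bernoulli) auto
    then have "(1 - ?q) * (1 + n * ?p n) \<le> 1" using iid_sequence_max_tail[OF X(1), of n "2 * t n"] by simp
    moreover have "1 / 2 * (n * ?p n) \<le> (1 - ?q) * (n * ?p n)"
      using q G by (intro mult_right_mono) auto
    ultimately show ?thesis using q by (simp add: algebra_simps)
  qed
  have "\<forall>\<^sub>F n in sequentially. ?G n < 1 / 4"
    using order_tendstoD(2)[OF lim, of "1 / 4"] by simp
  then have ev: "\<forall>\<^sub>F n in sequentially. real n * ?p n \<le> 4 * ?G n"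
    using eventually_ge_at_top[of 1] by eventually_elim (use * in auto)
  show ?thesis
    by (rule tendsto_sandwich[OF _ ev tendsto_const tendsto_mult_right_zero[OF lim]]) simp
qed

section \<open>Symmetrization by pairs of neighbouring coordinates\<close>

lemma iid_sequence_even_odd:
  fixes X :: "'a \<Rightarrow> 'b::{banach, second_countable_topology}"
  assumes X: "iid_sequence M X Xs"
  shows "iid_sequence M X (\<lambda>i. Xs (2 * i))" "iid_sequence M X (\<lambda>i. Xs (2 * i + 1))"
proof -
  note D = iid_sequenceD[OF X]
  \<comment> \<open>The first projection of each pair; its generic variable \<open>Xs 2\<close> has
    the law of \<open>X\<close> and may be exchanged for it.\<close>
  have "iid_sequence M (\<lambda>\<omega>. Xs 2 \<omega>) (\<lambda>i \<omega>. Xs (2 * i) \<omega>)"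
    by (rule iid_sequence_pairing(1)[OF X, of "\<lambda>x y. x"]) simp
  then show "iid_sequence M X (\<lambda>i. Xs (2 * i))"
    by (rule iid_sequence_const_law) (use D in auto)
  have "iid_sequence M (\<lambda>\<omega>. Xs 3 \<omega>) (\<lambda>i \<omega>. Xs (2 * i + 1) \<omega>)"
    by (rule iid_sequence_pairing(1)[OF X, of "\<lambda>x y. y"]) simp
  then show "iid_sequence M X (\<lambda>i. Xs (2 * i + 1))"
    by (rule iid_sequence_const_law) (use D in auto)
qed

text \<open>The scale \<open>r\<close> is left free: \<open>1/2\<close> preserves norm bounds and
  tail thresholds, while the converse direction needs a scale adapted to its level.\<close>

lemma iid_sequence_symmetrize:
  fixes X :: "'a \<Rightarrow> 'b::{banach, second_countable_topology}" and f :: "'b \<Rightarrow> 'b"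
  assumes X: "iid_sequence M X Xs" and [measurable]: "f \<in> borel_measurable borel"
  shows "iid_sequence M (\<lambda>\<omega>. r *\<^sub>R (f (Xs 2 \<omega>) - f (Xs 3 \<omega>)))
      (\<lambda>i \<omega>. r *\<^sub>R (f (Xs (2 * i) \<omega>) - f (Xs (2 * i + 1) \<omega>)))"
    and "symmetric_rv M (\<lambda>\<omega>. r *\<^sub>R (f (Xs 2 \<omega>) - f (Xs 3 \<omega>)))"
proof -
  have m: "(\<lambda>(x, y). r *\<^sub>R (f x - f y)) \<in> borel_measurable (borel \<Otimes>\<^sub>M borel)" by measurable
  show "iid_sequence M (\<lambda>\<omega>. r *\<^sub>R (f (Xs 2 \<omega>) - f (Xs 3 \<omega>)))
      (\<lambda>i \<omega>. r *\<^sub>R (f (Xs (2 * i) \<omega>) - f (Xs (2 * i + 1) \<omega>)))"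
    by (rule iid_sequence_pairing(1)[OF X m])
  show "symmetric_rv M (\<lambda>\<omega>. r *\<^sub>R (f (Xs 2 \<omega>) - f (Xs 3 \<omega>)))"
    by (rule symmetric_rv_pairing[OF X m]) (simp add: algebra_simps)
qed

lemma partial_sum_symmetrize:
  fixes f :: "'c \<Rightarrow> 'b::real_vector"
  shows "partial_sum (\<lambda>i \<omega>. r *\<^sub>R (f (Xs (2 * i) \<omega>) - f (Xs (2 * i + 1) \<omega>))) n \<omega> =
    r *\<^sub>R (partial_sum (\<lambda>i \<omega>. f (Xs (2 * i) \<omega>)) n \<omega> - partial_sum (\<lambda>i \<omega>. f (Xs (2 * i + 1) \<omega>)) n \<omega>)"
  by (simp add: partial_sum_def scaleR_sum_right scaleR_diff_right sum_subtractf)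

text \<open>Half a difference has norm at most the larger of the two norms, so the threshold is kept
  and only the factor 2 of a union bound is lost.\<close>

lemma iid_sequence_pair_tail_le:
  fixes X :: "'a \<Rightarrow> 'b::{banach, second_countable_topology}"
  assumes X: "iid_sequence M X Xs"
  shows "measure M {\<omega> \<in> space M. norm ((1/2) *\<^sub>R (Xs 2 \<omega> - Xs 3 \<omega>)) > t} \<le>
    2 * measure M {\<omega> \<in> space M. norm (X \<omega>) > t}"
proof -
  note D = iid_sequenceD[OF X]
  interpret prob_space M by (rule D)
  have [measurable]: "Xs 2 \<in> borel_measurable M" "Xs 3 \<in> borel_measurable M" by (auto intro: D)
  have p: "measure M {\<omega> \<in> space M. norm (Xs i \<omega>) > t} = measure M {\<omega> \<in> space M. norm (X \<omega>) > t}" if "i \<ge> 1" for i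
    by (rule measure_distr_eq[OF D(5)[OF that] D(4)[OF that] D(2)]) measurable
  have "measure M {\<omega> \<in> space M. norm ((1/2) *\<^sub>R (Xs 2 \<omega> - Xs 3 \<omega>)) > t} \<le>
      measure M ({\<omega> \<in> space M. norm (Xs 2 \<omega>) > t} \<union> {\<omega> \<in> space M. norm (Xs 3 \<omega>) > t})"
  proof (intro finite_measure_mono subsetI)
    fix \<omega> assume \<omega>: "\<omega> \<in> {\<omega> \<in> space M. norm ((1/2) *\<^sub>R (Xs 2 \<omega> - Xs 3 \<omega>)) > t}"
    then have "norm (Xs 2 \<omega>) > t \<or> norm (Xs 3 \<omega>) > t"
      using norm_triangle_ineq4[of "Xs 2 \<omega>" "Xs 3 \<omega>"] by auto
    with \<omega> show "\<omega> \<in> {\<omega> \<in> space M. norm (Xs 2 \<omega>) > t} \<union> {\<omega> \<in> space M. norm (Xs 3 \<omega>) > t}" by auto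
  qed measurable
  also have "\<dots> \<le> measure M {\<omega> \<in> space M. norm (Xs 2 \<omega>) > t} + measure M {\<omega> \<in> space M. norm (Xs 3 \<omega>) > t}"
    by (rule measure_Un_le) measurable
  finally show ?thesis using p[of 2] p[of 3] by simp
qed

text \<open>Weak desymmetrization: if one variable exceeds \<open>2 * t\<close> while the other
  stays within \<open>t\<close>, their difference exceeds \<open>t\<close>, and independence
  multiplies the two probabilities.\<close>

lemma iid_sequence_pair_tail_ge:
  fixes X :: "'a \<Rightarrow> 'b::{banach, second_countable_topology}"
  assumes X: "iid_sequence M X Xs"
  shows "measure M {\<omega> \<in> space M. norm (X \<omega>) > 2 * t} * measure M {\<omega> \<in> space M. norm (X \<omega>) \<le> t} \<le>
    measure M {\<omega> \<in> space M. norm (Xs 2 \<omega> - Xs 3 \<omega>) > t}"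
proof -
  note D = iid_sequenceD[OF X]
  interpret prob_space M by (rule D)
  have [measurable]: "Xs 2 \<in> borel_measurable M" "Xs 3 \<in> borel_measurable M" by (auto intro: D)
  define A where "A i = (if i = (2::nat) then {x::'b. norm x > 2 * t} else {x. norm x \<le> t})" for i
  have "measure M {\<omega> \<in> space M. norm (X \<omega>) > 2 * t} = prob (Xs 2 -` A 2 \<inter> space M)"
    using measure_distr_eq[OF D(5) D(4) D(2), of 2 "\<lambda>x. norm x > 2 * t"]
    by (simp add: A_def vimage_def Int_def conj_commute)
  moreover have "measure M {\<omega> \<in> space M. norm (X \<omega>) \<le> t} = prob (Xs 3 -` A 3 \<inter> space M)"
    using measure_distr_eq[OF D(5) D(4) D(2), of 3 "\<lambda>x. norm x \<le> t"]
    by (simp add: A_def vimage_def Int_def conj_commute)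
  moreover have "prob (\<Inter>i\<in>{2,3}. Xs i -` A i \<inter> space M) = (\<Prod>i\<in>{2,3}. prob (Xs i -` A i \<inter> space M))"
    by (intro indep_varsD[OF D(3)]) (auto simp: A_def)
  moreover have "(\<Inter>i\<in>{2,3}. Xs i -` A i \<inter> space M) \<subseteq> {\<omega> \<in> space M. norm (Xs 2 \<omega> - Xs 3 \<omega>) > t}"
  proof
    fix \<omega> assume "\<omega> \<in> (\<Inter>i\<in>{2,3}. Xs i -` A i \<inter> space M)"
    then have "\<omega> \<in> space M" "norm (Xs 2 \<omega>) > 2 * t" "norm (Xs 3 \<omega>) \<le> t" by (auto simp: A_def)
    then show "\<omega> \<in> {\<omega> \<in> space M. norm (Xs 2 \<omega> - Xs 3 \<omega>) > t}"
      using norm_triangle_ineq2[of "Xs 2 \<omega>" "Xs 3 \<omega>"] by simp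
  qed
  then have "prob (\<Inter>i\<in>{2,3}. Xs i -` A i \<inter> space M) \<le> prob {\<omega> \<in> space M. norm (Xs 2 \<omega> - Xs 3 \<omega>) > t}"
    by (intro finite_measure_mono) auto
  ultimately show ?thesis by simp
qed

text \<open>The even and the odd sum are independent and have the same mean. Subtracting the
  centered odd sum can only increase the expected norm, by Jensen's inequality, and the two
  centerings cancel in the difference.\<close>

lemma centered_partial_sum_symmetrization:
  fixes X :: "'a \<Rightarrow> 'b::{banach, second_countable_topology}" and f :: "'b \<Rightarrow> 'b"
  assumes X: "iid_sequence M X Xs" and f[measurable]: "f \<in> borel_measurable borel" and b: "\<And>x. norm (f x) \<le> c"
  shows "(\<integral>\<omega>. norm (partial_sum (\<lambda>i \<omega>. f (Xs (2 * i) \<omega>)) n \<omega> - real n *\<^sub>R (\<integral>\<omega>. f (X \<omega>) \<partial>M)) \<partial>M) \<le>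
    (\<integral>\<omega>. norm (partial_sum (\<lambda>i \<omega>. f (Xs (2 * i) \<omega>)) n \<omega> - partial_sum (\<lambda>i \<omega>. f (Xs (2 * i + 1) \<omega>)) n \<omega>) \<partial>M)"
proof -
  note D = iid_sequenceD[OF X]
  interpret prob_space M by (rule D)
  let ?m = "real n *\<^sub>R (\<integral>\<omega>. f (X \<omega>) \<partial>M)"
  let ?A = "\<lambda>\<omega>. partial_sum (\<lambda>i \<omega>. f (Xs (2 * i) \<omega>)) n \<omega> - ?m"
  let ?B = "\<lambda>\<omega>. partial_sum (\<lambda>i \<omega>. f (Xs (2 * i + 1) \<omega>)) n \<omega> - ?m"
  note eo = iid_sequence_even_odd[OF X]
  have intA: "integrable M (partial_sum (\<lambda>i \<omega>. f (Xs (2 * i) \<omega>)) n)"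
    using integrable_norm_partial_sum_bounded(1)[OF iid_sequence_compose[OF eo(1) f] b] by simp
  have intB: "integrable M (partial_sum (\<lambda>i \<omega>. f (Xs (2 * i + 1) \<omega>)) n)"
    using integrable_norm_partial_sum_bounded(1)[OF iid_sequence_compose[OF eo(2) f] b] by simp
  define E O' where "E = (\<lambda>i::nat. 2 * i) ` {1..n}" and "O' = (\<lambda>i::nat. 2 * i + 1) ` {1..n}"
  have m: "(\<lambda>x. (\<Sum>i\<in>{1..n}. f (x (k i))) - ?m) \<in> borel_measurable (PiM (k ` {1..n}) (\<lambda>_. borel))" for k :: "nat \<Rightarrow> nat"
  proof (intro borel_measurable_diff borel_measurable_sum borel_measurable_const)
    fix i assume "i \<in> {1..n}"
    then have "(\<lambda>x. x (k i)) \<in> measurable (PiM (k ` {1..n}) (\<lambda>_. borel)) (borel :: 'b measure)"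
      by (intro measurable_component_singleton) auto
    from measurable_compose[OF this f]
    show "(\<lambda>x. f (x (k i))) \<in> borel_measurable (PiM (k ` {1..n}) (\<lambda>_. borel))" .
  qed
  have "indep_var borel ((\<lambda>x. (\<Sum>i\<in>{1..n}. f (x (2 * i))) - ?m) \<circ> (\<lambda>\<omega>. restrict (\<lambda>i. Xs i \<omega>) E))
      borel ((\<lambda>x. (\<Sum>i\<in>{1..n}. f (x (2 * i + 1))) - ?m) \<circ> (\<lambda>\<omega>. restrict (\<lambda>i. Xs i \<omega>) O'))"
    unfolding E_def O'_def
  proof (rule indep_var_compose[OF indep_var_restrict[OF D(3)] m m])
    have "2 * i \<noteq> 2 * j + 1" for i j :: nat by presburger
    then show "(\<lambda>i::nat. 2 * i) ` {1..n} \<inter> (\<lambda>i::nat. 2 * i + 1) ` {1..n} = {}" by blast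
  qed auto
  also have "((\<lambda>x. (\<Sum>i\<in>{1..n}. f (x (2 * i))) - ?m) \<circ> (\<lambda>\<omega>. restrict (\<lambda>i. Xs i \<omega>) E)) = ?A"
    by (auto simp: fun_eq_iff partial_sum_def E_def intro!: sum.cong)
  also have "((\<lambda>x. (\<Sum>i\<in>{1..n}. f (x (2 * i + 1))) - ?m) \<circ> (\<lambda>\<omega>. restrict (\<lambda>i. Xs i \<omega>) O')) = ?B"
    by (auto simp: fun_eq_iff partial_sum_def O'_def intro!: sum.cong)
  finally have ind: "indep_var borel ?A borel ?B" .
  have int1: "integrable M (\<lambda>\<omega>. f (Z \<omega>))" if "Z \<in> borel_measurable M" for Z
    using that b measurable_compose[OF that f] by (intro integrable_const_bound[where B=c]) auto
  have "(\<integral>\<omega>. partial_sum (\<lambda>i \<omega>. f (Xs (2 * i + 1) \<omega>)) n \<omega> \<partial>M) = (\<Sum>i=1..n. \<integral>\<omega>. f (Xs (2 * i + 1) \<omega>) \<partial>M)"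
    unfolding partial_sum_def by (intro Bochner_Integration.integral_sum int1 D) auto
  also have "\<dots> = (\<Sum>i=1..n. \<integral>\<omega>. f (X \<omega>) \<partial>M)"
  proof (intro sum.cong refl)
    fix i :: nat
    have "(\<integral>\<omega>. f (Xs (2 * i + 1) \<omega>) \<partial>M) = (\<integral>x. f x \<partial>distr M borel (Xs (2 * i + 1)))"
      by (subst integral_distr) (auto intro: D)
    also have "\<dots> = (\<integral>\<omega>. f (X \<omega>) \<partial>M)"
      using D(2) by (subst D(5)) (auto simp: integral_distr)
    finally show "(\<integral>\<omega>. f (Xs (2 * i + 1) \<omega>) \<partial>M) = (\<integral>\<omega>. f (X \<omega>) \<partial>M)" .
  qed
  finally have "(\<integral>\<omega>. ?B \<omega> \<partial>M) = 0"
    using intB by (simp add: prob_space sum_constant_scaleR)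
  from expectation_norm_le_diff[OF ind _ _ this] show ?thesis
    using intA intB by simp
qed

section \<open>The two implications for a fixed sequence\<close>

context
  fixes a b :: "nat \<Rightarrow> real"
    and M :: "'a measure"
    and X :: "'a \<Rightarrow> 'b::{banach, second_countable_topology}"
    and Xs :: "nat \<Rightarrow> 'a \<Rightarrow> 'b"
  assumes a: "\<And>n. n \<ge> 1 \<Longrightarrow> a n > 0" and b: "\<And>n. n \<ge> 1 \<Longrightarrow> b n > 0"
    and mono: "mono_on {1..} a" and ratio: "mono_on {1..} (\<lambda>n. b n / a n)"
    and lim: "filterlim b at_top sequentially"
    and wl: "symmetric_weak_law TYPE('b) a"
    and X: "iid_sequence M X Xs"
begin

interpretation prob_space M by (rule iid_sequenceD(1)[OF X])

lemma symmetric_weak_law_rescaled: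
  fixes Y :: "'a \<Rightarrow> 'b"
  assumes "iid_sequence M Y Ys" "symmetric_rv M Y"
    and "(\<lambda>n. real n * measure M {\<omega> \<in> space M. norm (Y \<omega>) > b n}) \<longlonglongrightarrow> 0" and "\<epsilon> > 0"
  shows "(\<lambda>n. measure M {\<omega> \<in> space M. norm (partial_sum Ys n \<omega>) > \<epsilon> * b n}) \<longlonglongrightarrow> 0"
  by (rule symmetric_weak_law_comparison[OF a b mono ratio lim wl assms])

lemma weak_law_centered:
  assumes tail: "(\<lambda>n. real n * measure M {\<omega> \<in> space M. norm (X \<omega>) > b n}) \<longlonglongrightarrow> 0" and \<epsilon>: "\<epsilon> > 0"
  shows "(\<lambda>n. measure M {\<omega> \<in> space M. norm (partial_sum Xs n \<omega> - centering M X b n) > \<epsilon> * b n}) \<longlonglongrightarrow> 0"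
proof -
  note D = iid_sequenceD[OF X]
  note [measurable] = D(2)
  note eo = iid_sequence_even_odd[OF X]
  let ?p = "\<lambda>n. real n * measure M {\<omega> \<in> space M. norm (X \<omega>) > b n}"
  define z where "z n x = (if norm x \<le> b n then x else 0)" for n and x :: 'b
  have z[measurable]: "z n \<in> borel_measurable borel" for n unfolding z_def by measurable
  have zb: "norm (z n x) \<le> b n" if "n \<ge> 1" for n x using b[OF that] by (simp add: z_def)
  have id: "(\<lambda>x::'b. x) \<in> borel_measurable borel" by simp
  \<comment> \<open>\<open>?V\<close> symmetrizes the variables and \<open>?T n\<close> their
    truncations. With the factor \<open>1/2\<close> the summands of \<open>?T n\<close> are bounded
    by \<open>b n\<close>, as the passage to L1 requires.\<close>
  let ?V = "\<lambda>i \<omega>. (1/2) *\<^sub>R (Xs (2 * i) \<omega> - Xs (2 * i + 1) \<omega>)"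
  let ?T = "\<lambda>n i \<omega>. (1/2) *\<^sub>R (z n (Xs (2 * i) \<omega>) - z n (Xs (2 * i + 1) \<omega>))"
  note V = iid_sequence_symmetrize[OF X id, of "1/2"]
  note T = iid_sequence_symmetrize[OF X z, of "1/2"]
  have Vtail: "(\<lambda>n. real n * measure M {\<omega> \<in> space M. norm ((1/2) *\<^sub>R (Xs 2 \<omega> - Xs 3 \<omega>)) > b n}) \<longlonglongrightarrow> 0"
  proof (rule tendsto_sandwich[OF _ _ tendsto_const tendsto_mult_right_zero[OF tail, of 2]])
    show "\<forall>\<^sub>F n in sequentially. real n * measure M {\<omega> \<in> space M. norm ((1/2) *\<^sub>R (Xs 2 \<omega> - Xs 3 \<omega>)) > b n} \<le> 2 * ?p n"
      using mult_left_mono[OF iid_sequence_pair_tail_le[OF X] of_nat_0_le_iff] by (simp add: mult.left_commute)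
  qed simp
  have Vconv: "(\<lambda>n. measure M {\<omega> \<in> space M. norm (partial_sum ?V n \<omega>) > \<delta> * b n}) \<longlonglongrightarrow> 0" if "\<delta> > 0" for \<delta>
    by (rule symmetric_weak_law_rescaled[OF V Vtail that])
  have Tconv: "(\<lambda>n. measure M {\<omega> \<in> space M. norm (partial_sum (?T n) n \<omega>) > \<delta> * b n}) \<longlonglongrightarrow> 0" if "\<delta> > 0" for \<delta>
  proof (rule tendsto_sandwich[OF _ _ tendsto_const])
    \<comment> \<open>One \<open>?p n\<close> pays for large summands at even positions, the other
      for those at odd positions.\<close>
    let ?u = "\<lambda>n. measure M {\<omega> \<in> space M. norm (partial_sum ?V n \<omega>) > \<delta> * b n} + (?p n + ?p n)"
    show "?u \<longlonglongrightarrow> 0" by (intro tendsto_add_zero Vconv that tail)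
    have "measure M {\<omega> \<in> space M. norm (partial_sum (?T n) n \<omega>) > \<delta> * b n} \<le> ?u n" for n
    proof -
      let ?A = "{\<omega> \<in> space M. norm (partial_sum ?V n \<omega>) > \<delta> * b n}"
      let ?B = "{\<omega> \<in> space M. \<exists>i\<in>{1..n}. norm (Xs (2 * i) \<omega>) > b n}"
      let ?C = "{\<omega> \<in> space M. \<exists>i\<in>{1..n}. norm (Xs (2 * i + 1) \<omega>) > b n}"
      have [measurable]: "partial_sum ?V n \<in> borel_measurable M" by (rule partial_sum_measurable[OF V(1)])
      have mA: "?A \<in> sets M" by measurable
      have "{\<omega> \<in> space M. norm (Xs i \<omega>) > b n} \<in> sets M" if "i \<ge> 1" for i using D(4)[OF that] by measurable
      then have mB: "?B \<in> sets M" and mC: "?C \<in> sets M" by (intro sets.sets_Collect_finite_Ex; simp)+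
      have "measure M {\<omega> \<in> space M. norm (partial_sum (?T n) n \<omega>) > \<delta> * b n} \<le> measure M (?A \<union> (?B \<union> ?C))"
      proof (intro finite_measure_mono subsetI)
        fix \<omega> assume \<omega>: "\<omega> \<in> {\<omega> \<in> space M. norm (partial_sum (?T n) n \<omega>) > \<delta> * b n}"
        show "\<omega> \<in> ?A \<union> (?B \<union> ?C)"
        proof (rule ccontr)
          assume n: "\<omega> \<notin> ?A \<union> (?B \<union> ?C)"
          then have "partial_sum (?T n) n \<omega> = partial_sum ?V n \<omega>"
            using \<omega> unfolding partial_sum_def by (intro sum.cong refl) (auto simp: z_def not_less)
          with n \<omega> show False by simp
        qed
      qed (use mA mB mC in auto)
      also have "\<dots> \<le> measure M ?A + (measure M ?B + measure M ?C)"
        using measure_Un_le[of ?A M "?B \<union> ?C"] measure_Un_le[of ?B M ?C] mA mB mC by auto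
      also have "\<dots> \<le> ?u n"
        by (intro add_mono order_refl iid_sequence_union_bound[OF eo(1)] iid_sequence_union_bound[OF eo(2)]) measurable
      finally show ?thesis .
    qed
    then show "\<forall>\<^sub>F n in sequentially. measure M {\<omega> \<in> space M. norm (partial_sum (?T n) n \<omega>) > \<delta> * b n} \<le> ?u n" by simp
  qed simp
  have TL1: "(\<lambda>n. (\<integral>\<omega>. norm (partial_sum (?T n) n \<omega>) \<partial>M) / b n) \<longlonglongrightarrow> 0"
  proof (rule Hoffmann_Jorgensen_L1_convergence[OF T _ b Tconv])
    fix n i :: nat and \<omega> assume n: "n \<ge> 1"
    show "norm (?T n i \<omega>) \<le> b n"
      using norm_triangle_ineq4[of "z n (Xs (2 * i) \<omega>)" "z n (Xs (2 * i + 1) \<omega>)"]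
        zb[OF n, of "Xs (2 * i) \<omega>"] zb[OF n, of "Xs (2 * i + 1) \<omega>"] by simp
  qed
  let ?I = "\<lambda>n. \<integral>\<omega>. norm (partial_sum (?T n) n \<omega>) \<partial>M"
  \<comment> \<open>The centering is exactly the mean of the sum of \<open>n\<close> truncated
    variables.\<close>
  have \<gamma>: "centering M X b n = real n *\<^sub>R (\<integral>\<omega>. z n (X \<omega>) \<partial>M)" for n
    unfolding centering_def set_lebesgue_integral_def
    by (intro arg_cong[where f="\<lambda>x. real n *\<^sub>R x"] Bochner_Integration.integral_cong) (auto simp: z_def)
  have bnd: "(\<lambda>n. (2 / \<epsilon>) * (?I n / b n) + ?p n) \<longlonglongrightarrow> 0"
    by (rule tendsto_add_zero[OF tendsto_mult_right_zero[OF TL1] tail])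
  show ?thesis
  proof (rule tendsto_sandwich[OF _ _ tendsto_const bnd])
    show "\<forall>\<^sub>F n in sequentially. measure M {\<omega> \<in> space M. norm (partial_sum Xs n \<omega> - centering M X b n) > \<epsilon> * b n}
      \<le> (2 / \<epsilon>) * (?I n / b n) + ?p n"
      using eventually_ge_at_top[of 1]
    proof eventually_elim
      case (elim n)
      have bn: "b n > 0" by (rule b[OF elim])
      let ?\<gamma> = "centering M X b n"
      let ?E = "\<lambda>\<omega>. partial_sum (\<lambda>i \<omega>. z n (Xs (2 * i) \<omega>)) n \<omega>"
      note E = iid_sequence_compose[OF eo(1) z[of n]]
      have [measurable]: "?E \<in> borel_measurable M" using partial_sum_measurable[OF E] by simp
      have "measure M {\<omega> \<in> space M. norm (partial_sum Xs n \<omega> - ?\<gamma>) > \<epsilon> * b n} \<le>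
        measure M {\<omega> \<in> space M. norm (partial_sum (\<lambda>i \<omega>. z n (Xs i \<omega>)) n \<omega> - ?\<gamma>) > \<epsilon> * b n} + ?p n"
        by (rule partial_sum_truncation_bound[OF X _ _ id z[of n], where Q="\<lambda>x. norm (x - ?\<gamma>) > \<epsilon> * b n"])
          (auto simp: z_def)
      \<comment> \<open>The sum is replaced by the equally distributed sum over even positions, so
        that the odd positions are free to act as the independent copy.\<close>
      also have "measure M {\<omega> \<in> space M. norm (partial_sum (\<lambda>i \<omega>. z n (Xs i \<omega>)) n \<omega> - ?\<gamma>) > \<epsilon> * b n} =
        measure M {\<omega> \<in> space M. norm (?E \<omega> - ?\<gamma>) > \<epsilon> * b n}"
        by (rule iid_sequence_partial_sum_prob_eq[OF iid_sequence_compose[OF X z[of n]] E refl]) measurable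
      also have "\<dots> \<le> (\<integral>\<omega>. norm (?E \<omega> - ?\<gamma>) \<partial>M) / (\<epsilon> * b n)"
        using \<epsilon> bn integrable_norm_partial_sum_bounded(1)[OF E zb[OF elim], of n]
        by (intro norm_tail_le_expectation) auto
      also have "(\<integral>\<omega>. norm (?E \<omega> - ?\<gamma>) \<partial>M) \<le>
        (\<integral>\<omega>. norm (?E \<omega> - partial_sum (\<lambda>i \<omega>. z n (Xs (2 * i + 1) \<omega>)) n \<omega>) \<partial>M)"
        unfolding \<gamma> by (rule centered_partial_sum_symmetrization[OF X z zb[OF elim]])
      \<comment> \<open>The 2 undoes the factor \<open>1/2\<close> in \<open>?T\<close>.\<close>
      also have "\<dots> = 2 * ?I n"
        unfolding partial_sum_symmetrize by simp
      finally show ?case using \<epsilon> bn by (simp add: field_simps)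
    qed
  qed simp
qed

text \<open>The vectors \<open>v n\<close> may be arbitrary because they cancel in the difference of
  two copies. A single level \<open>l\<close> suffices because the symmetric law, once its tail
  condition is available at one scale, holds at every scale.\<close>

lemma tail_of_weak_law_centered:
  assumes l: "l > 0"
    and conv: "(\<lambda>n. measure M {\<omega> \<in> space M. norm (partial_sum Xs n \<omega> - v n) > l * b n}) \<longlonglongrightarrow> 0"
  shows "(\<lambda>n. real n * measure M {\<omega> \<in> space M. norm (X \<omega>) > b n}) \<longlonglongrightarrow> 0"
proof -
  note D = iid_sequenceD[OF X]
  note [measurable] = D(2)
  note eo = iid_sequence_even_odd[OF X]
  have id: "(\<lambda>x::'b. x) \<in> borel_measurable borel" by simp
  let ?D = "\<lambda>\<omega>. Xs 2 \<omega> - Xs 3 \<omega>"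
  \<comment> \<open>Chosen so that a scaled difference above \<open>b n / 2\<close> is an unscaled
    one above \<open>2 * l * b n\<close>, forcing one copy beyond \<open>l * b n\<close>. The tail
    lemma doubles \<open>b n / 2\<close> to exactly \<open>b n\<close>, the threshold in the
    symmetric law.\<close>
  define r where "r = 1 / (4 * l)"
  have r: "r > 0" using l by (simp add: r_def)
  let ?V = "\<lambda>i \<omega>. r *\<^sub>R (Xs (2 * i) \<omega> - Xs (2 * i + 1) \<omega>)"
  note V = iid_sequence_symmetrize[OF X id, of r]
  let ?S1 = "partial_sum (\<lambda>i \<omega>. Xs (2 * i) \<omega>)" and ?S2 = "partial_sum (\<lambda>i \<omega>. Xs (2 * i + 1) \<omega>)"
  let ?q = "\<lambda>n. measure M {\<omega> \<in> space M. norm (partial_sum Xs n \<omega> - v n) > l * b n}"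
  have "(\<lambda>n. measure M {\<omega> \<in> space M. norm (partial_sum ?V n \<omega>) > (1/2) * b n}) \<longlonglongrightarrow> 0"
  proof (rule tendsto_sandwich[OF _ _ tendsto_const tendsto_add_zero[OF conv conv]])
    have "measure M {\<omega> \<in> space M. norm (partial_sum ?V n \<omega>) > (1/2) * b n} \<le> ?q n + ?q n" for n
    proof -
      have [measurable]: "?S1 n \<in> borel_measurable M" "?S2 n \<in> borel_measurable M"
        using partial_sum_measurable[OF eo(1)] partial_sum_measurable[OF eo(2)] by simp_all
      let ?A = "{\<omega> \<in> space M. norm (?S1 n \<omega> - v n) > l * b n}" and ?B = "{\<omega> \<in> space M. norm (?S2 n \<omega> - v n) > l * b n}"
      have "measure M {\<omega> \<in> space M. norm (partial_sum ?V n \<omega>) > (1/2) * b n} \<le> measure M (?A \<union> ?B)"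
      proof (intro finite_measure_mono subsetI)
        fix \<omega> assume \<omega>: "\<omega> \<in> {\<omega> \<in> space M. norm (partial_sum ?V n \<omega>) > (1/2) * b n}"
        have "norm (partial_sum ?V n \<omega>) = r * norm ((?S1 n \<omega> - v n) - (?S2 n \<omega> - v n))"
          unfolding partial_sum_symmetrize[where f="\<lambda>x. x"] using r by simp
        also have "\<dots> \<le> r * (norm (?S1 n \<omega> - v n) + norm (?S2 n \<omega> - v n))"
          using r by (intro mult_left_mono norm_triangle_ineq4) auto
        finally have "(1/2) * b n < r * (norm (?S1 n \<omega> - v n) + norm (?S2 n \<omega> - v n))" using \<omega> by simp
        then have "2 * (l * b n) < norm (?S1 n \<omega> - v n) + norm (?S2 n \<omega> - v n)"
          using l by (simp add: r_def field_simps)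
        then have "norm (?S1 n \<omega> - v n) > l * b n \<or> norm (?S2 n \<omega> - v n) > l * b n" by linarith
        with \<omega> show "\<omega> \<in> ?A \<union> ?B" by auto
      qed measurable
      also have "\<dots> \<le> measure M ?A + measure M ?B" by (rule measure_Un_le) measurable
      also have "measure M ?A = ?q n"
        by (rule iid_sequence_partial_sum_prob_eq[OF eo(1) X refl]) measurable
      also have "measure M ?B = ?q n"
        by (rule iid_sequence_partial_sum_prob_eq[OF eo(2) X refl]) measurable
      finally show ?thesis .
    qed
    then show "\<forall>\<^sub>F n in sequentially. measure M {\<omega> \<in> space M. norm (partial_sum ?V n \<omega>) > (1/2) * b n} \<le> ?q n + ?q n" by simp
  qed simp
  from symmetric_tail_of_partial_sum[OF V _ this]
  have Vtail: "(\<lambda>n. real n * measure M {\<omega> \<in> space M. norm (r *\<^sub>R ?D \<omega>) > b n}) \<longlonglongrightarrow> 0"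
    using b by (simp add: less_imp_le)
  \<comment> \<open>So far the tail of \<open>?D\<close> is controlled only at
    \<open>4 * l * b n\<close>. The symmetric law permits any multiple of \<open>b n\<close>; with
    \<open>r / 4\<close>, doubling in the tail lemma gives \<open>r / 2\<close>, which is the
    threshold \<open>b n / 2\<close> for \<open>?D\<close>.\<close>
  have "(\<lambda>n. measure M {\<omega> \<in> space M. norm (partial_sum ?V n \<omega>) > r / 4 * b n}) \<longlonglongrightarrow> 0"
    by (rule symmetric_weak_law_rescaled[OF V Vtail]) (use r in simp)
  from symmetric_tail_of_partial_sum[OF V _ this]
  have "(\<lambda>n. real n * measure M {\<omega> \<in> space M. norm (r *\<^sub>R ?D \<omega>) > 2 * (r / 4 * b n)}) \<longlonglongrightarrow> 0"
    using b r by (simp add: less_imp_le)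
  moreover have "norm (r *\<^sub>R ?D \<omega>) > 2 * (r / 4 * b n) \<longleftrightarrow> norm (?D \<omega>) > b n / 2" for n \<omega>
    using mult_less_cancel_left_pos[OF r, of "b n / 2" "norm (?D \<omega>)"] r by simp
  ultimately have Dtail: "(\<lambda>n. real n * measure M {\<omega> \<in> space M. norm (?D \<omega>) > b n / 2}) \<longlonglongrightarrow> 0"
    by simp
  \<comment> \<open>A single random variable is tight and \<open>b n / 2\<close> diverges, so the
    second factor in the desymmetrization bound is eventually at least \<open>1 / 2\<close>.\<close>
  have half: "\<forall>\<^sub>F n in sequentially. measure M {\<omega> \<in> space M. norm (X \<omega>) \<le> b n / 2} \<ge> 1 / 2"
  proof -
    interpret N: real_distribution "distr M borel (\<lambda>\<omega>. norm (X \<omega>))"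
      by (rule real_distribution_distr) measurable
    have "((\<lambda>x. cdf (distr M borel (\<lambda>\<omega>. norm (X \<omega>))) x) \<longlongrightarrow> 1) at_top"
      by (rule N.cdf_lim_at_top_prob)
    then have "\<forall>\<^sub>F x in at_top. cdf (distr M borel (\<lambda>\<omega>. norm (X \<omega>))) x > 1 / 2"
      by (rule order_tendstoD) simp
    moreover have "filterlim (\<lambda>n. b n / 2) at_top sequentially"
      using filterlim_at_top_mult_tendsto_pos[OF tendsto_const[of "1/2"] _ lim] by simp
    ultimately have "\<forall>\<^sub>F n in sequentially. cdf (distr M borel (\<lambda>\<omega>. norm (X \<omega>))) (b n / 2) > 1 / 2"
      by (rule eventually_compose_filterlim)
    then show ?thesis
      by (rule eventually_mono)
        (simp add: cdf_def measure_distr vimage_def Int_def conj_commute)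
  qed
  show ?thesis
  proof (rule tendsto_sandwich[OF _ _ tendsto_const tendsto_mult_right_zero[OF Dtail, of 2]])
    show "\<forall>\<^sub>F n in sequentially. real n * measure M {\<omega> \<in> space M. norm (X \<omega>) > b n} \<le>
        2 * (real n * measure M {\<omega> \<in> space M. norm (?D \<omega>) > b n / 2})"
      using half
    proof eventually_elim
      case (elim n)
      let ?P = "measure M {\<omega> \<in> space M. norm (X \<omega>) > b n}"
      have "?P * (1 / 2) \<le> ?P * measure M {\<omega> \<in> space M. norm (X \<omega>) \<le> b n / 2}"
        using elim by (intro mult_left_mono) auto
      also have "\<dots> \<le> measure M {\<omega> \<in> space M. norm (?D \<omega>) > b n / 2}"
        using iid_sequence_pair_tail_ge[OF X, of "b n / 2"] by simp
      finally have "?P \<le> 2 * measure M {\<omega> \<in> space M. norm (?D \<omega>) > b n / 2}" by simp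
      then show ?case using mult_left_mono[of ?P _ "real n"] by (simp add: mult.left_commute)
    qed
  qed simp
qed

end

section \<open>Limits superior and the combined statement\<close>

lemma tendsto_0_if_limsup_nonpos:
  fixes f :: "nat \<Rightarrow> real"
  assumes nn: "\<And>n. f n \<ge> 0" and ls: "\<not> limsup (\<lambda>n. ereal (f n)) > 0"
  shows "f \<longlonglongrightarrow> 0"
proof -
  have "liminf (\<lambda>n. ereal (f n)) \<ge> 0" using nn by (intro Liminf_bounded) simp
  moreover have "liminf (\<lambda>n. ereal (f n)) \<le> limsup (\<lambda>n. ereal (f n))"
    by (rule Liminf_le_Limsup) simp
  ultimately have "liminf (\<lambda>n. ereal (f n)) = 0" "limsup (\<lambda>n. ereal (f n)) = 0" using ls by auto
  then have "(\<lambda>n. ereal (f n)) \<longlonglongrightarrow> ereal 0"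
    by (intro Liminf_eq_Limsup) (simp_all add: zero_ereal_def)
  then show ?thesis by simp
qed

theorem theorem1p1:
  fixes a b :: "nat \<Rightarrow> real"
    and M :: "'a measure"
    and X :: "'a \<Rightarrow> 'b::{banach, second_countable_topology}"
    and Xs :: "nat \<Rightarrow> 'a \<Rightarrow> 'b"
  assumes "\<forall>n\<ge>1. a n > 0" and "\<forall>n\<ge>1. b n > 0"
    and "strict_mono_on {1..} a" and "strict_mono_on {1..} b"
    and "filterlim a at_top sequentially"
    and "mono_on {1..} (\<lambda>n. b n / a n)"
    and "symmetric_weak_law TYPE('b) a"
    and "iid_sequence M X Xs"
  shows "((\<lambda>n. real n * measure M {\<omega> \<in> space M. norm (X \<omega>) > b n}) \<longlonglongrightarrow> 0 \<longrightarrow>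
            converges_in_prob M
              (\<lambda>n \<omega>. (partial_sum Xs n \<omega> - centering M X b n) /\<^sub>R b n) (\<lambda>_. 0)) \<and>
         (limsup (\<lambda>n. ereal (real n * measure M {\<omega> \<in> space M. norm (X \<omega>) > b n})) > 0 \<longrightarrow>
            (\<forall>l>0. limsup (\<lambda>n. ereal (measure M {\<omega> \<in> space M.
                norm (partial_sum Xs n \<omega> - centering M X b n) / b n > l})) > 0))"
proof -
  have a: "\<And>n. n \<ge> 1 \<Longrightarrow> a n > 0" and b: "\<And>n. n \<ge> 1 \<Longrightarrow> b n > 0" using assms(1,2) by auto
  have mono: "mono_on {1..} a" using assms(3) by (rule strict_mono_on_imp_mono_on)
  \<comment> \<open>The ratio \<open>b n / a n\<close> never falls below its value at 1, so
    \<open>b\<close> inherits divergence from \<open>a\<close>.\<close>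
  have lim: "filterlim b at_top sequentially"
  proof (rule filterlim_at_top_mono)
    show "filterlim (\<lambda>n. b 1 / a 1 * a n) at_top sequentially"
      using a[of 1] b[of 1] by (intro filterlim_tendsto_pos_mult_at_top[OF tendsto_const _ assms(5)]) simp
    show "\<forall>\<^sub>F n in sequentially. b 1 / a 1 * a n \<le> b n"
      using eventually_ge_at_top[of 1]
    proof eventually_elim
      case (elim n)
      then show ?case using mono_onD[OF assms(6), of 1 n] a[OF elim] by (simp add: field_simps)
    qed
  qed
  let ?Z = "\<lambda>n \<omega>. partial_sum Xs n \<omega> - centering M X b n"
  let ?P = "\<lambda>l n. measure M {\<omega> \<in> space M. norm (?Z n \<omega>) > l * b n}"
  let ?p = "\<lambda>n. real n * measure M {\<omega> \<in> space M. norm (X \<omega>) > b n}"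
  note rules = a b mono assms(6) lim assms(7,8)
  have eq: "\<forall>\<^sub>F n in sequentially. measure M {\<omega> \<in> space M. norm (?Z n \<omega>) / b n > l} = ?P l n" for l
    using eventually_ge_at_top[of 1]
  proof eventually_elim
    case (elim n)
    then show ?case using b[OF elim] by (simp add: pos_less_divide_eq)
  qed
  show ?thesis
  proof (intro conjI impI allI)
    assume tail: "?p \<longlonglongrightarrow> 0"
    show "converges_in_prob M (\<lambda>n \<omega>. ?Z n \<omega> /\<^sub>R b n) (\<lambda>_. 0)"
      unfolding converges_in_prob_def
    proof (intro allI impI)
      fix \<epsilon> :: real assume "\<epsilon> > 0"
      have "?P \<epsilon> \<longlonglongrightarrow> 0" by (rule weak_law_centered[OF rules tail \<open>\<epsilon> > 0\<close>])
      moreover have "\<forall>\<^sub>F n in sequentially. ?P \<epsilon> n = measure M {\<omega> \<in> space M. dist (?Z n \<omega> /\<^sub>R b n) 0 > \<epsilon>}"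
        using eq[of \<epsilon>] eventually_ge_at_top[of 1]
      proof eventually_elim
        case (elim n)
        have "dist (?Z n \<omega> /\<^sub>R b n) 0 = norm (?Z n \<omega>) / b n" for \<omega>
          using b[OF elim(2)] by (simp add: divide_inverse_commute)
        with elim(1) show ?case by simp
      qed
      ultimately show "(\<lambda>n. measure M {\<omega> \<in> space M. dist (?Z n \<omega> /\<^sub>R b n) 0 > \<epsilon>}) \<longlonglongrightarrow> 0"
        by (rule Lim_transform_eventually)
    qed
  next
    fix l :: real
    assume pos: "limsup (\<lambda>n. ereal (?p n)) > 0" and l: "l > 0"
    show "limsup (\<lambda>n. ereal (measure M {\<omega> \<in> space M. norm (?Z n \<omega>) / b n > l})) > 0"
    \<comment> \<open>A limit superior that fails to be positive at the single level
      \<open>l\<close> makes these probabilities tend to 0, which forces the tail condition and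
      contradicts \<open>pos\<close>.\<close>
    proof (rule ccontr)
      assume "\<not> ?thesis"
      then have "(\<lambda>n. measure M {\<omega> \<in> space M. norm (?Z n \<omega>) / b n > l}) \<longlonglongrightarrow> 0"
        by (intro tendsto_0_if_limsup_nonpos) auto
      then have "?P l \<longlonglongrightarrow> 0" using eq by (rule Lim_transform_eventually)
      then have "?p \<longlonglongrightarrow> 0" by (intro tail_of_weak_law_centered[OF rules l])
      then have "(\<lambda>n. ereal (?p n)) \<longlonglongrightarrow> ereal 0" by simp
      then have "limsup (\<lambda>n. ereal (?p n)) = ereal 0" by (intro lim_imp_Limsup) auto
      with pos show False by simp
    qed
  qed
qed

end
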